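(* Let $n\geq 2$ be an integer and let $\mathbb F_n=\Lambda^1(\mathbb R^n)\times\Lambda^2(\mathbb R^n)$ be the free step-two Carnot group of rank $n$. Then $\mathcal A_h(\mathbb F_n)$ and $\oplus_{k=0}^n\Lambda^k(\mathbb R^n)$ are isomorphic as real vector spaces. Namely, a map $f:\mathbb F_n\to\mathbb R$ belongs to $\mathcal A_h(\mathbb F_n)$ if and only if there is $(\eta_0,\dots,\eta_n)\in\oplus_{k=0}^n\Lambda^k(\mathbb R^n)$ (with $\eta_k\in\Lambda^k(\mathbb R^n)$) such that for all $(\theta,\omega)\in\mathbb F_n$, $$f(\theta,\omega)\,dx_1\wedge\cdots\wedge dx_n=\sum_{k=0}^{\lfloor n/2\rfloor}\omega^k\wedge\eta_{n-2k}+\sum_{k=0}^{\lfloor (n-1)/2\rfloor}\theta\wedge\omega^k\wedge\eta_{n-2k-1}.$$ Furthermore, such an $(\eta_0,\dots,\eta_n)$ is unique. More precisely, if $f\in\mathcal A_h(\mathbb F_n)$, then for every $(\theta,\omega)\in\mathbb F_n$ the map $t\in(0,+\infty)\mapsto (f\circ\delta_t)(\theta,\omega)$ is a polynomial of degree $\leq n$, and, writing $f_j(\theta,\omega):=\frac{1}{j!}\frac{d^j}{dt^j}(f\circ\delta_t)(\theta,\omega)\big|_{t=0}$ for its coefficients, we have $$\omega^k\wedge\eta_{n-2k}=f_{2k}(\theta,\omega)\,dx_1\wedge\cdots\wedge dx_n\quad\text{for }k\in\{0,\dots,\lfloor n/2\rfloor\},$$ $$\theta\wedge\omega^k\wedge\eta_{n-2k-1}=f_{2k+1}(\theta,\omega)\,dx_1\wedge\cdots\wedge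 dx_n\quad\text{for }k\in\{0,\dots,\lfloor (n-1)/2\rfloor\}.$$
   Context: $\Lambda^k(\mathbb R^n)$ denotes the space of alternating $k$-linear forms on $\mathbb R^n$, and $(dx_1,\dots,dx_n)$ is a fixed basis of $\Lambda^1(\mathbb R^n)$. The free step-two Carnot group of rank $n$ is $\mathbb F_n:=\Lambda^1(\mathbb R^n)\times\Lambda^2(\mathbb R^n)$ with group law $(\theta,\omega)\cdot(\theta',\omega')=(\theta+\theta',\omega+\omega'+\theta\wedge\theta')$. For $t>0$, $\delta_t(\theta,\omega):=(t\theta,t^2\omega)$. A map $f:\mathbb F_n\to\mathbb R$ is horizontally affine ($h$-affine), written $f\in\mathcal A_h(\mathbb F_n)$, if for all $(\theta,\omega)\in\mathbb F_n$ and $\theta'\in\Lambda^1(\mathbb R^n)$ the map $t\in\mathbb R\mapsto f((\theta,\omega)\cdot(t\theta',0))$ is affine. $\omega^k$ denotes the $k$-th exterior power $\omega\wedge\cdots\wedge\omega$ ($\omega^0=1$), and $\lfloor p\rfloor$ is the integer part of $p$. *)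

theory Defs
  imports "HOL-Computational_Algebra.Polynomial"
begin

text \<open>Exterior algebra of \<open>\<real>^n\<close> in coordinates: a form is given by its coefficients
  w.r.t. the basis \<open>dx_I = dx_{i_1} \<and> ... \<and> dx_{i_k}\<close> (\<open>I = {i_1 < ... < i_k} \<subseteq> {0..<n}\<close>).
  Index \<open>i\<close> corresponds to \<open>dx_{i+1}\<close>.\<close>

type_synonym form = "nat set \<Rightarrow> real"

definition Lambda :: "nat \<Rightarrow> nat \<Rightarrow> form set" where
  "Lambda n k = {\<alpha>. \<forall>I. \<alpha> I \<noteq> 0 \<longrightarrow> I \<subseteq> {..<n} \<and> card I = k}"

definition shuffle_sign :: "nat set \<Rightarrow> nat set \<Rightarrow> real" where
  "shuffle_sign J K = (-1) ^ card {(a, b). a \<in> J \<and> b \<in> K \<and> b < a}"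

definition wedge :: "form \<Rightarrow> form \<Rightarrow> form" where
  "wedge \<alpha> \<beta> = (\<lambda>I. \<Sum>J\<in>Pow I. shuffle_sign J (I - J) * \<alpha> J * \<beta> (I - J))"

definition form_one :: form where
  "form_one = (\<lambda>I. if I = {} then 1 else 0)"

primrec wpow :: "form \<Rightarrow> nat \<Rightarrow> form" where
  "wpow \<omega> 0 = form_one"
| "wpow \<omega> (Suc k) = wedge \<omega> (wpow \<omega> k)"

definition vol :: "nat \<Rightarrow> form" where
  "vol n = (\<lambda>I. if I = {..<n} then 1 else 0)"

definition form_add :: "form \<Rightarrow> form \<Rightarrow> form" where
  "form_add \<alpha> \<beta> = (\<lambda>I. \<alpha> I + \<beta> I)"

definition form_scale :: "real \<Rightarrow> form \<Rightarrow> form" where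
  "form_scale c \<alpha> = (\<lambda>I. c * \<alpha> I)"

definition Fn :: "nat \<Rightarrow> (form \<times> form) set" where
  "Fn n = Lambda n 1 \<times> Lambda n 2"

definition Fmult :: "form \<times> form \<Rightarrow> form \<times> form \<Rightarrow> form \<times> form" where
  "Fmult p q = (form_add (fst p) (fst q),
                form_add (form_add (snd p) (snd q)) (wedge (fst p) (fst q)))"

definition dil :: "real \<Rightarrow> form \<times> form \<Rightarrow> form \<times> form" where
  "dil t p = (form_scale t (fst p), form_scale (t\<^sup>2) (snd p))"

definition h_affine :: "nat \<Rightarrow> (form \<times> form \<Rightarrow> real) \<Rightarrow> bool" where
  "h_affine n f \<longleftrightarrow> (\<forall>p\<in>Fn n. \<forall>\<theta>'\<in>Lambda n 1. \<exists>a b. \<forall>t::real.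
      f (Fmult p (form_scale t \<theta>', (\<lambda>_. 0))) = a + b * t)"

definition represents :: "nat \<Rightarrow> (form \<times> form \<Rightarrow> real) \<Rightarrow> (nat \<Rightarrow> form) \<Rightarrow> bool" where
  "represents n f \<eta> \<longleftrightarrow> (\<forall>k. \<eta> k \<in> Lambda n k) \<and>
     (\<forall>\<theta> \<omega>. (\<theta>, \<omega>) \<in> Fn n \<longrightarrow>
        form_scale (f (\<theta>, \<omega>)) (vol n) =
        (\<lambda>I. (\<Sum>k\<le>n div 2. wedge (wpow \<omega> k) (\<eta> (n - 2*k)) I)
           + (\<Sum>k\<le>(n - 1) div 2. wedge \<theta> (wedge (wpow \<omega> k) (\<eta> (n - 2*k - 1))) I)))"

end

theory Submission
  imports Defs "HOL-Combinatorics.Permutations"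
begin

text \<open>Two horizontal lines with the same projected direction, together with the horizontal lines
  joining them, sweep out a hyperbolic paraboloid on which \<open>f\<close> is affine along both rulings. The second
  ruling is not horizontal, and hence \<open>f\<close> is affine along every direction
  \<open>(u, u \<and> b)\<close> and \<open>(0, u \<and> b)\<close>. Under the identification \<open>\<Lambda>\<^sup>1(\<real>\<^sup>n) \<times> \<Lambda>\<^sup>2(\<real>\<^sup>n) = \<Lambda>\<^sup>2(\<real>\<^sup>n\<^sup>+\<^sup>1)\<close>
  these are exactly the decomposable directions \<open>y \<and> z\<close>.

  If such an \<open>f\<close> vanishes on all sums of \<open>m\<close> decomposable forms, then
  \<open>(v\<^sub>1, \<dots>, v\<^sub>2\<^sub>m\<^sub>+\<^sub>2) \<mapsto> f (v\<^sub>1 \<and> v\<^sub>2 + \<dots> + v\<^sub>2\<^sub>m\<^sub>+\<^sub>1 \<and> v\<^sub>2\<^sub>m\<^sub>+\<^sub>2)\<close> is multilinear and alternating: if the same vector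
  occurs in two different summands, these combine into one decomposable form. By induction
  \<open>f\<close> is determined by its values at \<open>2\<^sup>n\<close> points indexed by subsets \<open>J\<close> of the basis. Evaluating the
  candidate expansions at these points gives a system that is triangular with respect to \<open>card J\<close>, which
  yields both existence and uniqueness of the coefficients.\<close>

section \<open>Wedge products in coordinates\<close>

lemma shuffle_sign_union_left:
  assumes "finite A" "finite B" "finite C" "A \<inter> B = {}"
  shows "shuffle_sign (A \<union> B) C = shuffle_sign A C * shuffle_sign B C"
proof -
  have fin: "finite {(a, b). a \<in> X \<and> b \<in> C \<and> b < a}" if "finite X" for X
    by (rule finite_subset[of _ "X \<times> C"]) (use that assms in auto)
  have "{(a, b). a \<in> A \<union> B \<and> b \<in> C \<and> b < a}
      = {(a, b). a \<in> A \<and> b \<in> C \<and> b < a} \<union> {(a, b). a \<in> B \<and> b \<in> C \<and> b < a}"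
    by auto
  then have "card {(a, b). a \<in> A \<union> B \<and> b \<in> C \<and> b < a}
      = card {(a, b). a \<in> A \<and> b \<in> C \<and> b < a} + card {(a, b). a \<in> B \<and> b \<in> C \<and> b < a}"
    using assms fin by (simp only:) (subst card_Un_disjoint, auto)
  then show ?thesis
    by (simp add: shuffle_sign_def power_add)
qed

lemma shuffle_sign_union_right:
  assumes "finite A" "finite B" "finite C" "B \<inter> C = {}"
  shows "shuffle_sign A (B \<union> C) = shuffle_sign A B * shuffle_sign A C"
proof -
  have fin: "finite {(a, b). a \<in> A \<and> b \<in> X \<and> b < a}" if "finite X" for X
    by (rule finite_subset[of _ "A \<times> X"]) (use that assms in auto)
  have "{(a, b). a \<in> A \<and> b \<in> B \<union> C \<and> b < a}
      = {(a, b). a \<in> A \<and> b \<in> B \<and> b < a} \<union> {(a, b). a \<in> A \<and> b \<in> C \<and> b < a}"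
    by auto
  then have "card {(a, b). a \<in> A \<and> b \<in> B \<union> C \<and> b < a}
      = card {(a, b). a \<in> A \<and> b \<in> B \<and> b < a} + card {(a, b). a \<in> A \<and> b \<in> C \<and> b < a}"
    using assms fin by (simp only:) (subst card_Un_disjoint, auto)
  then show ?thesis
    by (simp add: shuffle_sign_def power_add)
qed

text \<open>For distinct \<open>a\<close> in \<open>A\<close> and \<open>b\<close> in
  \<open>B\<close> exactly one of the two orders is an inversion. Hence the inversion counts of
  \<open>(A, B)\<close> and \<open>(B, A)\<close> add up to \<open>card A * card B\<close>.\<close>

lemma shuffle_sign_swap:
  assumes "finite A" "finite B" "A \<inter> B = {}"
  shows "shuffle_sign B A = (-1) ^ (card A * card B) * shuffle_sign A B"
proof -
  let ?P = "{(a, b). a \<in> A \<and> b \<in> B \<and> b < a}" and ?Q = "{(a, b). a \<in> A \<and> b \<in> B \<and> a < b}"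
  have fin: "finite ?P" "finite ?Q"
    by (rule finite_subset[of _ "A \<times> B"]; use assms in auto)+
  have prod: "A \<times> B = ?P \<union> ?Q"
    using assms(3) by (auto simp: disjoint_iff) (metis linorder_less_linear)
  have "card (A \<times> B) = card ?P + card ?Q"
    unfolding prod using fin by (rule card_Un_disjoint) auto
  then have "card A * card B = card ?P + card ?Q"
    by (simp add: card_cartesian_product)
  moreover have "card ?Q = card {(a, b). a \<in> B \<and> b \<in> A \<and> b < a}"
    by (rule bij_betw_same_card[of prod.swap], rule bij_betw_byWitness[where f' = prod.swap]) auto
  ultimately show ?thesis
    by (simp add: shuffle_sign_def power_add flip: power_mult_distrib)
qed

lemma shuffle_sign_nonzero: "shuffle_sign J K \<noteq> 0"
  by (simp add: shuffle_sign_def)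

text \<open>For infinite \<open>I\<close> the index set \<open>Pow I\<close> is infinite, and the
  sum takes its default value 0. This settles infinite index sets in the identities below.\<close>

lemma wedge_infinite: "infinite I \<Longrightarrow> wedge \<alpha> \<beta> I = 0"
  by (simp add: wedge_def)

text \<open>Both sides run over the splittings of \<open>I\<close> into three blocks
  \<open>K\<close>, \<open>L\<close>, \<open>M\<close>. As the shuffle sign is multiplicative in
  each argument, both carry the product of the signs of \<open>(K, L)\<close>, \<open>(K, M)\<close>
  and \<open>(L, M)\<close>.\<close>

lemma wedge_assoc: "wedge (wedge \<alpha> \<beta>) \<gamma> = wedge \<alpha> (wedge \<beta> \<gamma>)"
proof
  fix I show "wedge (wedge \<alpha> \<beta>) \<gamma> I = wedge \<alpha> (wedge \<beta> \<gamma>) I"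
  proof (cases "finite I")
    case fin: True
    have "wedge (wedge \<alpha> \<beta>) \<gamma> I = (\<Sum>(J, K)\<in>Sigma (Pow I) Pow.
        shuffle_sign J (I - J) * (shuffle_sign K (J - K) * \<alpha> K * \<beta> (J - K)) * \<gamma> (I - J))"
      using fin by (simp add: wedge_def sum_distrib_left sum_distrib_right)
        (subst sum.Sigma, auto intro: finite_subset)
    also have "\<dots> = (\<Sum>(K, L)\<in>Sigma (Pow I) (\<lambda>K. Pow (I - K)).
        shuffle_sign K (I - K) * \<alpha> K * (shuffle_sign L (I - K - L) * \<beta> L * \<gamma> (I - K - L)))"
    proof (rule sum.reindex_bij_witness[where i = "\<lambda>(K, L). (K \<union> L, K)" and j = "\<lambda>(J, K). (K, J - K)"],
        goal_cases)
      case (5 p)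
      obtain J K where p: "p = (J, K)" "J \<subseteq> I" "K \<subseteq> J" using 5 by auto
      define L where "L = J - K"
      define M where "M = I - J"
      have eq: "J = K \<union> L" "I - K = L \<union> M" "I - J = M" "I - K - L = M" "J - K = L"
        using p by (auto simp: L_def M_def)
      have f: "finite K" "finite L" "finite M" "K \<inter> L = {}" "L \<inter> M = {}"
        using p fin by (auto simp: L_def M_def intro: finite_subset)
      have "shuffle_sign J M = shuffle_sign K M * shuffle_sign L M"
        unfolding eq(1) using f by (intro shuffle_sign_union_left)
      moreover have "shuffle_sign K (I - K) = shuffle_sign K L * shuffle_sign K M"
        unfolding eq(2) using f by (intro shuffle_sign_union_right)
      ultimately show ?case
        by (simp add: p(1) eq(3-5))
    qed auto
    also have "\<dots> = wedge \<alpha> (wedge \<beta> \<gamma>) I"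
      using fin by (simp add: wedge_def sum_distrib_left sum_distrib_right)
        (subst sum.Sigma, auto intro: finite_subset)
    finally show ?thesis .
  qed (simp add: wedge_infinite)
qed

text \<open>Complementation in \<open>I\<close> matches the terms. The nonzero ones have blocks of
  sizes \<open>p\<close> and \<open>q\<close>, so swapping the blocks costs the same sign in
  each.\<close>

lemma wedge_graded_commute:
  assumes "\<alpha> \<in> Lambda n p" "\<beta> \<in> Lambda n q"
  shows "wedge \<beta> \<alpha> = form_scale ((-1) ^ (p * q)) (wedge \<alpha> \<beta>)"
proof
  fix I show "wedge \<beta> \<alpha> I = form_scale ((-1) ^ (p * q)) (wedge \<alpha> \<beta>) I"
  proof (cases "finite I")
    case fin: True
    show ?thesis
      unfolding wedge_def form_scale_def sum_distrib_left
    proof (rule sum.reindex_bij_witness[where i = "\<lambda>J. I - J" and j = "\<lambda>J. I - J"], goal_cases)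
      case (5 J)
      have J: "J \<subseteq> I" "finite J" using 5 fin by (auto intro: finite_subset)
      then have IJ: "I - (I - J) = J" by auto
      show ?case
      proof (cases "\<alpha> (I - J) \<noteq> 0 \<and> \<beta> J \<noteq> 0")
        case True
        then have c: "card (I - J) = p" "card J = q"
          using assms by (auto simp: Lambda_def)
        have "shuffle_sign J (I - J) = (-1) ^ (p * q) * shuffle_sign (I - J) J"
          using shuffle_sign_swap[of "I - J" J] fin J c by auto
        then show ?thesis by (simp add: IJ)
      qed (auto simp: IJ)
    qed auto
  qed (simp add: wedge_infinite form_scale_def)
qed

lemma wedge_mem_Lambda:
  assumes "\<alpha> \<in> Lambda n p" "\<beta> \<in> Lambda n q"
  shows "wedge \<alpha> \<beta> \<in> Lambda n (p + q)"
  unfolding Lambda_def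
proof (intro CollectI allI impI)
  fix I assume nz: "wedge \<alpha> \<beta> I \<noteq> 0"
  then obtain J where J: "J \<subseteq> I" "\<alpha> J \<noteq> 0" "\<beta> (I - J) \<noteq> 0"
    unfolding wedge_def by (auto elim!: sum.not_neutral_contains_not_neutral)
  have "finite I" using nz wedge_infinite by blast
  then have "card I = card J + card (I - J)"
    using J(1) by (metis card_Diff_subset card_mono finite_subset le_add_diff_inverse)
  then show "I \<subseteq> {..<n} \<and> card I = p + q"
    using J assms unfolding Lambda_def by blast
qed

lemma form_one_mem_Lambda: "form_one \<in> Lambda n 0"
  by (auto simp: form_one_def Lambda_def split: if_splits)

lemma wpow_mem_Lambda: "\<omega> \<in> Lambda n 2 \<Longrightarrow> wpow \<omega> k \<in> Lambda n (2 * k)"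
proof (induction k)
  case (Suc k)
  then show ?case using wedge_mem_Lambda[of \<omega> n 2 "wpow \<omega> k" "2 * k"] by simp
qed (simp add: form_one_mem_Lambda)

lemma form_add_mem_Lambda: "\<alpha> \<in> Lambda n k \<Longrightarrow> \<beta> \<in> Lambda n k \<Longrightarrow> form_add \<alpha> \<beta> \<in> Lambda n k"
  unfolding Lambda_def form_add_def mem_Collect_eq by (metis add.right_neutral add.left_neutral)

lemma form_scale_mem_Lambda: "\<alpha> \<in> Lambda n k \<Longrightarrow> form_scale c \<alpha> \<in> Lambda n k"
  by (auto simp: Lambda_def form_scale_def)

lemma wedge_add_left: "wedge (form_add \<alpha> \<beta>) \<gamma> = form_add (wedge \<alpha> \<gamma>) (wedge \<beta> \<gamma>)"
  by (auto simp: wedge_def form_add_def algebra_simps sum.distrib)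

lemma wedge_add_right: "wedge \<gamma> (form_add \<alpha> \<beta>) = form_add (wedge \<gamma> \<alpha>) (wedge \<gamma> \<beta>)"
  by (auto simp: wedge_def form_add_def algebra_simps sum.distrib)

lemma wedge_scale_left: "wedge (form_scale c \<alpha>) \<gamma> = form_scale c (wedge \<alpha> \<gamma>)"
  by (auto simp: wedge_def form_scale_def algebra_simps sum_distrib_left)

lemma wedge_scale_right: "wedge \<gamma> (form_scale c \<alpha>) = form_scale c (wedge \<gamma> \<alpha>)"
  by (auto simp: wedge_def form_scale_def algebra_simps sum_distrib_left)

lemma wedge_zero_left: "wedge (\<lambda>_. 0) \<gamma> = (\<lambda>_. 0)"
  by (auto simp: wedge_def)

lemma wedge_zero_right: "wedge \<gamma> (\<lambda>_. 0) = (\<lambda>_. 0)"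
  by (auto simp: wedge_def)

lemma wedge_self_zero:
  assumes "\<alpha> \<in> Lambda n 1" shows "wedge \<alpha> \<alpha> = (\<lambda>_. 0)"
proof
  fix I show "wedge \<alpha> \<alpha> I = 0"
    using fun_cong[OF wedge_graded_commute[OF assms assms], of I] by (simp add: form_scale_def)
qed

lemma wedge_decomposable_square:
  assumes "\<alpha> \<in> Lambda n 1" "\<beta> \<in> Lambda n 1"
  shows "wedge (wedge \<alpha> \<beta>) (wedge \<alpha> \<beta>) = (\<lambda>_. 0)"
proof -
  have "wedge \<beta> (wedge \<alpha> \<beta>) = form_scale (-1) (wedge \<alpha> (wedge \<beta> \<beta>))"
    using wedge_graded_commute[OF assms] by (simp add: wedge_scale_left flip: wedge_assoc)
  then show ?thesis
    by (simp add: wedge_assoc wedge_self_zero[OF assms(2)] wedge_zero_right wedge_scale_right)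
      (simp add: form_scale_def wedge_zero_right)
qed

section \<open>Powers of two-forms and their behaviour along horizontal lines\<close>

lemma form_add_zero_right: "form_add \<alpha> (\<lambda>_. 0) = \<alpha>"
  by (simp add: form_add_def)

lemma form_scale_zero: "form_scale c (\<lambda>_. 0) = (\<lambda>_. 0)"
  by (simp add: form_scale_def)

lemma wpow_scale: "wpow (form_scale c \<omega>) k = form_scale (c ^ k) (wpow \<omega> k)"
  by (induction k) (auto simp: wedge_scale_left wedge_scale_right, auto simp: form_scale_def fun_eq_iff)

text \<open>The binomial expansion for commuting \<open>\<omega>\<close> and \<open>d\<close> stops
  after the linear term because \<open>d\<close> squares to zero.\<close>

lemma wpow_add_square_zero:
  assumes "wedge d d = (\<lambda>_. 0)" "wedge \<omega> d = wedge d \<omega>"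
  shows "wpow (form_add \<omega> (form_scale t d)) (Suc k)
       = form_add (wpow \<omega> (Suc k)) (form_scale (t * Suc k) (wedge d (wpow \<omega> k)))"
proof (induction k)
  case 0
  then show ?case by (simp add: wedge_add_left wedge_scale_left)
next
  case (Suc k)
  have 1: "wedge d (wedge d \<psi>) = (\<lambda>_. 0)" for \<psi>
    by (simp add: assms wedge_zero_left flip: wedge_assoc)
  have 2: "wedge \<omega> (wedge d \<psi>) = wedge d (wedge \<omega> \<psi>)" for \<psi>
    by (simp add: assms flip: wedge_assoc)
  show ?case
    unfolding wpow.simps(2)[of "form_add \<omega> (form_scale t d)" "Suc k"] Suc.IH
    by (simp add: wedge_add_left wedge_add_right wedge_scale_left wedge_scale_right 1 2)
      (auto simp: form_add_def form_scale_def fun_eq_iff algebra_simps)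
qed

lemma Lambda_commute2:
  assumes "\<omega> \<in> Lambda n 2" "d \<in> Lambda n 2"
  shows "wedge \<omega> d = wedge d \<omega>"
  using wedge_graded_commute[OF assms] by (simp add: form_scale_def)

lemma Lambda_anticommute:
  assumes "\<alpha> \<in> Lambda n 1" "\<beta> \<in> Lambda n 1"
  shows "wedge \<alpha> \<beta> = form_scale (-1) (wedge \<beta> \<alpha>)"
  using wedge_graded_commute[OF assms(2,1)] by simp

text \<open>The form of weight \<open>d\<close> that is paired with \<open>\<eta>\<^bsub>n - d\<^esub>\<close>.\<close>

definition weight_form :: "nat \<Rightarrow> form \<times> form \<Rightarrow> form" where
  "weight_form d p = (if even d then wpow (snd p) (d div 2) else wedge (fst p) (wpow (snd p) (d div 2)))"

lemma weight_form_mem_Lambda: "p \<in> Fn n \<Longrightarrow> weight_form d p \<in> Lambda n d"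
  using wpow_mem_Lambda[of "snd p" n "d div 2"] wedge_mem_Lambda[of "fst p" n 1 "wpow (snd p) (d div 2)" "d - 1"]
  by (auto simp: weight_form_def Fn_def elim!: oddE)

lemma weight_form_dil: "weight_form d (dil t p) = form_scale (t ^ d) (weight_form d p)"
proof (cases "even d")
  case True
  then show ?thesis
    by (auto simp: weight_form_def dil_def wpow_scale power_mult[symmetric] elim!: evenE)
next
  case False
  then obtain k where d: "d = 2 * k + 1" by (rule oddE)
  have "wedge (form_scale t (fst p)) (wpow (form_scale (t\<^sup>2) (snd p)) k)
      = form_scale (t ^ d) (wedge (fst p) (wpow (snd p) k))"
    unfolding wpow_scale wedge_scale_left wedge_scale_right
    by (auto simp: form_scale_def d power_mult[symmetric])
  then show ?thesis by (simp add: weight_form_def dil_def d)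
qed

text \<open>Along the line the two-form changes by \<open>t\<close> times \<open>\<delta>\<close>,
  the wedge of \<open>x\<close> and \<open>u\<close>. As \<open>\<delta>\<close> squares to zero,
  all its powers are affine in \<open>t\<close>. In odd weight, every term in which
  \<open>\<delta>\<close> meets \<open>x\<close> or \<open>u\<close> contains a repeated vector and
  vanishes, so no quadratic term arises.\<close>

lemma weight_form_horizontal_affine:
  assumes "p \<in> Fn n" "u \<in> Lambda n 1"
  shows "\<exists>\<psi>. \<forall>t. weight_form d (Fmult p (form_scale t u, \<lambda>_. 0)) = form_add (weight_form d p) (form_scale t \<psi>)"
proof -
  obtain x \<omega> where p: "p = (x, \<omega>)" "x \<in> Lambda n 1" "\<omega> \<in> Lambda n 2"
    using assms(1) by (auto simp: Fn_def)
  define \<delta> where "\<delta> = wedge x u"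
  have xx: "wedge x (wedge x \<psi>) = (\<lambda>_. 0)" "wedge u (wedge u \<psi>) = (\<lambda>_. 0)" for \<psi>
    using wedge_self_zero p(2) assms(2) by (simp_all add: wedge_zero_left flip: wedge_assoc)
  have ux: "wedge u (wedge x \<psi>) = form_scale (-1) (wedge x (wedge u \<psi>))" for \<psi>
    using Lambda_anticommute[OF assms(2) p(2)] by (simp add: wedge_scale_left flip: wedge_assoc)
  have xd: "wedge x (wedge \<delta> \<psi>) = (\<lambda>_. 0)" and ud: "wedge u (wedge \<delta> \<psi>) = (\<lambda>_. 0)" for \<psi>
    by (simp_all add: \<delta>_def wedge_assoc xx ux wedge_zero_right form_scale_zero)
  have dd: "wedge \<delta> \<delta> = (\<lambda>_. 0)"
    unfolding \<delta>_def by (rule wedge_decomposable_square[OF p(2) assms(2)])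
  have comm: "wedge \<omega> \<delta> = wedge \<delta> \<omega>"
    using wedge_mem_Lambda[OF p(2) assms(2)] p(3) unfolding \<delta>_def one_add_one by (rule Lambda_commute2[rotated])
  \<comment> \<open>\<open>\<chi> k\<close> is the \<open>t\<close>-derivative of the
    \<open>k\<close>-th power; the zeroth power is constant.\<close>
  define \<chi> where "\<chi> k = (case k of 0 \<Rightarrow> \<lambda>_. 0 | Suc j \<Rightarrow> form_scale k (wedge \<delta> (wpow \<omega> j)))" for k
  have pow: "wpow (form_add \<omega> (form_scale t \<delta>)) k = form_add (wpow \<omega> k) (form_scale t (\<chi> k))" for t k
  proof (cases k)
    case (Suc j)
    show ?thesis
      unfolding Suc wpow_add_square_zero[OF dd comm]
      by (simp add: \<chi>_def form_scale_def form_add_def fun_eq_iff algebra_simps)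
  qed (simp add: \<chi>_def form_scale_def form_add_def)
  have ch0: "wedge x (\<chi> k) = (\<lambda>_. 0)" "wedge u (\<chi> k) = (\<lambda>_. 0)" for k
    by (cases k; simp add: \<chi>_def wedge_zero_right wedge_scale_right xd ud form_scale_zero)+
  have F: "Fmult p (form_scale t u, \<lambda>_. 0) = (form_add x (form_scale t u), form_add \<omega> (form_scale t \<delta>))" for t
    by (simp add: Fmult_def p form_add_zero_right wedge_scale_right \<delta>_def)
  show ?thesis
  proof (cases "even d")
    case True
    then show ?thesis
      by (intro exI[of _ "\<chi> (d div 2)"]) (simp add: weight_form_def F[unfolded p(1)] pow p(1))
  next
    case False
    have "weight_form d (Fmult p (form_scale t u, \<lambda>_. 0))
        = form_add (weight_form d p) (form_scale t (wedge u (wpow \<omega> (d div 2))))" for t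
      using False unfolding F weight_form_def fst_conv snd_conv pow wedge_add_left wedge_add_right
        wedge_scale_left wedge_scale_right ch0 form_scale_zero form_add_zero_right
      by (simp add: p(1))
    then show ?thesis by blast
  qed
qed

section \<open>Functions affine along decomposable directions\<close>

definition real_affine :: "(real \<Rightarrow> real) \<Rightarrow> bool" where
  "real_affine h \<longleftrightarrow> (\<exists>a b. \<forall>t. h t = a + b * t)"

lemma real_affine_interpolate:
  assumes "real_affine h"
  shows "h t = (1 - t) * h 0 + t * h 1"
  using assms by (auto simp: real_affine_def algebra_simps)

lemma real_affine_combine:
  assumes "real_affine g" "real_affine h"
  shows "real_affine (\<lambda>t. c * g t + d * h t)"
proof -
  obtain a b a' b' where "\<forall>t. g t = a + b * t" "\<forall>t. h t = a' + b' * t"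
    using assms unfolding real_affine_def by blast
  then show ?thesis
    unfolding real_affine_def
    by (intro exI[of _ "c * a + d * a'"] exI[of _ "c * b + d * b'"]) (simp add: algebra_simps)
qed

text \<open>At \<open>t\<close> the point \<open>(x, W) \<cdot> (t u, 0)\<close> is joined to \<open>(x, W) \<cdot> (w, 0) \<cdot> (- t u, 0)\<close> by the horizontal line in
  direction \<open>w - 2 t u\<close>, and \<open>s\<close> is the parameter on that line.\<close>

lemma horizontal_ruling:
  fixes G :: "(nat \<Rightarrow> real) \<Rightarrow> (nat \<Rightarrow> nat \<Rightarrow> real) \<Rightarrow> real"
  assumes hor: "\<And>x W u. real_affine
    (\<lambda>t. G (\<lambda>i. x i + t * u i) (\<lambda>i j. W i j + t * (x i * u j - x j * u i)))"
  shows "real_affine (\<lambda>t. G (\<lambda>i. x i + s * w i + t * ((1 - 2 * s) * u i))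
    (\<lambda>i j. W i j + s * (x i * w j - x j * w i)
      + t * ((1 - 2 * s) * (x i * u j - x j * u i) + s * (u i * w j - u j * w i))))"
    (is "real_affine (?H s)")
proof -
  \<comment> \<open>Interpolation in \<open>s\<close> reduces the claim to \<open>s = 0\<close> and
    \<open>s = 1\<close>, where the rulings are themselves horizontal lines in
    \<open>t\<close>.\<close>
  have "?H s t = (1 - s) * ?H 0 t + s * ?H 1 t" for t
  proof -
    have "(\<lambda>s. ?H s t) = (\<lambda>s. G (\<lambda>i. (x i + t * u i) + s * (w i - 2 * t * u i))
        (\<lambda>i j. (W i j + t * (x i * u j - x j * u i))
          + s * ((x i + t * u i) * (w j - 2 * t * u j) - (x j + t * u j) * (w i - 2 * t * u i))))"
      by (intro ext arg_cong2[where f = G]) (simp_all add: algebra_simps)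
    then have "real_affine (\<lambda>s. ?H s t)"
      using hor[of "\<lambda>i. x i + t * u i" "\<lambda>i. w i - 2 * t * u i"] by simp
    from real_affine_interpolate[OF this, of s] show ?thesis .
  qed
  moreover have "real_affine (?H 0)"
    using hor[of x u W] by simp
  moreover have "real_affine (?H 1)"
  proof -
    have "?H 1 = (\<lambda>t. G (\<lambda>i. (x i + w i) + t * (- u i))
      (\<lambda>i j. (W i j + (x i * w j - x j * w i)) + t * ((x i + w i) * (- u j) - (x j + w j) * (- u i))))"
      by (intro ext arg_cong2[where f = G]) (simp_all add: algebra_simps)
    then show ?thesis
      using hor[of "\<lambda>i. x i + w i" "\<lambda>i. - u i"] by simp
  qed
  ultimately show ?thesis
    using real_affine_combine[of "?H 0" "?H 1" "1 - s" s] by simp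
qed

text \<open>At \<open>s = 1/2\<close> the factor \<open>1 - 2 * s\<close> vanishes, so the ruling
  moves only in the second component, along half the wedge of \<open>u\<close> and \<open>w\<close>.
  Taking \<open>w = 2 b\<close> gives the wanted direction; the base point is shifted so that the
  ruling passes through \<open>(x, W)\<close>.\<close>

lemma horizontal_affine_imp_vertical:
  fixes G :: "(nat \<Rightarrow> real) \<Rightarrow> (nat \<Rightarrow> nat \<Rightarrow> real) \<Rightarrow> real"
  assumes hor: "\<And>x W u. real_affine
    (\<lambda>t. G (\<lambda>i. x i + t * u i) (\<lambda>i j. W i j + t * (x i * u j - x j * u i)))"
  shows "real_affine (\<lambda>t. G x (\<lambda>i j. W i j + t * (u i * b j - u j * b i)))"
proof -
  have "(\<lambda>t. G x (\<lambda>i j. W i j + t * (u i * b j - u j * b i))) =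
    (\<lambda>t. G (\<lambda>i. (x i - b i) + (1/2) * (2 * b i) + t * ((1 - 2 * (1/2)) * u i))
    (\<lambda>i j. (W i j - (x i * b j - x j * b i)) + (1/2) * ((x i - b i) * (2 * b j) - (x j - b j) * (2 * b i))
      + t * ((1 - 2 * (1/2)) * ((x i - b i) * u j - (x j - b j) * u i) + (1/2) * (u i * (2 * b j) - u j * (2 * b i)))))"
    by (intro ext arg_cong2[where f = G]) (simp_all add: algebra_simps)
  then show ?thesis
    using horizontal_ruling[OF hor, where x = "\<lambda>i. x i - b i" and s = "1/2" and w = "\<lambda>i. 2 * b i" and u = u
        and W = "\<lambda>i j. W i j - (x i * b j - x j * b i)"] by simp
qed

text \<open>The ruling at \<open>s = -1\<close> moves both components. Any \<open>s\<close> other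
  than 0, 1/2 and 1 would serve.\<close>

lemma horizontal_affine_imp_sheared:
  fixes G :: "(nat \<Rightarrow> real) \<Rightarrow> (nat \<Rightarrow> nat \<Rightarrow> real) \<Rightarrow> real"
  assumes hor: "\<And>x W u. real_affine
    (\<lambda>t. G (\<lambda>i. x i + t * u i) (\<lambda>i j. W i j + t * (x i * u j - x j * u i)))"
  shows "real_affine (\<lambda>t. G (\<lambda>i. x i + t * u i) (\<lambda>i j. W i j + t * (u i * b j - u j * b i)))"
proof -
  \<comment> \<open>With \<open>u / 3\<close> in place of \<open>u\<close>, starting over
    \<open>x\<close> means \<open>x0 - w = x\<close>, and having the wanted direction means
    \<open>x0 + w / 3 = - b\<close>. These two equations determine \<open>w\<close> and
    \<open>x0\<close>.\<close>
  define w where "w i = - (3/4) * (b i + x i)" for i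
  define x0 where "x0 i = x i + w i" for i
  have "(\<lambda>t. G (\<lambda>i. x i + t * u i) (\<lambda>i j. W i j + t * (u i * b j - u j * b i))) =
    (\<lambda>t. G (\<lambda>i. x0 i + (-1) * w i + t * ((1 - 2 * (-1)) * (u i / 3)))
    (\<lambda>i j. (W i j + (x0 i * w j - x0 j * w i)) + (-1) * (x0 i * w j - x0 j * w i)
      + t * ((1 - 2 * (-1)) * (x0 i * (u j / 3) - x0 j * (u i / 3)) + (-1) * ((u i / 3) * w j - (u j / 3) * w i))))"
    by (intro ext arg_cong2[where f = G]) (simp_all add: field_simps x0_def w_def)
  then show ?thesis
    using horizontal_ruling[OF hor, where x = x0 and s = "-1" and w = w and u = "\<lambda>i. u i / 3"
        and W = "\<lambda>i j. W i j + (x0 i * w j - x0 j * w i)"] by simp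
qed

text \<open>Affinity on lines through 0 gives homogeneity. Additivity follows since
  \<open>u + w\<close> is the midpoint of \<open>2 u\<close> and \<open>2 w\<close>.\<close>

lemma line_affine_linear:
  fixes L :: "(nat \<Rightarrow> real) \<Rightarrow> real"
  assumes line: "\<And>u w. real_affine (\<lambda>t. L (\<lambda>i. u i + t * w i))" and zero: "L (\<lambda>_. 0) = 0"
  shows "finite A \<Longrightarrow> L (\<lambda>i. \<Sum>j\<in>A. c j * b j i) = (\<Sum>j\<in>A. c j * L (b j))"
proof -
  have scale: "L (\<lambda>i. r * u i) = r * L u" for r u
    using real_affine_interpolate[OF line[of "\<lambda>_. 0" u], of r] zero by simp
  have add: "L (\<lambda>i. u i + w i) = L u + L w" for u w
  proof -
    have "L (\<lambda>i. 2 * u i + (1/2) * (2 * w i - 2 * u i)) = (1/2) * L (\<lambda>i. 2 * u i) + (1/2) * L (\<lambda>i. 2 * w i)"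
      using real_affine_interpolate[OF line[of "\<lambda>i. 2 * u i" "\<lambda>i. 2 * w i - 2 * u i"], of "1/2"] by simp
    moreover have "(\<lambda>i. 2 * u i + (1/2) * (2 * w i - 2 * u i)) = (\<lambda>i. u i + w i)"
      by (auto simp: field_simps)
    ultimately show ?thesis by (simp only: scale)
  qed
  show "finite A \<Longrightarrow> ?thesis"
    by (induction A rule: finite_induct) (simp_all add: zero add scale)
qed

section \<open>Alternating multilinear functions of vector tuples\<close>

definition basis_vec :: "nat \<Rightarrow> nat \<Rightarrow> real" where
  "basis_vec j i = (if i = j then 1 else 0)"

text \<open>Multilinearity reduces the claim to tuples of basis vectors; alternation discards those
  with repetitions and sorts the others up to sign.\<close>

lemma alternating_vanish:
  fixes \<Phi> :: "(nat \<Rightarrow> nat \<Rightarrow> real) \<Rightarrow> real"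
  assumes cong: "\<And>v v'. (\<And>i. i < N \<Longrightarrow> v i = v' i) \<Longrightarrow> \<Phi> v = \<Phi> v'"
    and expand: "\<And>i v u. i < N \<Longrightarrow> \<Phi> (v(i := u)) = (\<Sum>j\<le>n. u j * \<Phi> (v(i := basis_vec j)))"
    and alt: "\<And>i i' v. i < N \<Longrightarrow> i' < N \<Longrightarrow> i \<noteq> i' \<Longrightarrow> v i = v i' \<Longrightarrow> \<Phi> v = 0"
    and base: "\<And>s. strict_mono_on {..<N} s \<Longrightarrow> s ` {..<N} \<subseteq> {..n} \<Longrightarrow> \<Phi> (\<lambda>i. basis_vec (s i)) = 0"
  shows "\<Phi> v = 0"
proof -
  have add: "\<Phi> (v(i := \<lambda>p. a p + b p)) = \<Phi> (v(i := a)) + \<Phi> (v(i := b))" if "i < N" for i v a b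
    using that by (simp add: expand[of i v a] expand[of i v b] expand[of i v "\<lambda>p. a p + b p"]
        distrib_right sum.distrib)
  \<comment> \<open>Polarization: inserting \<open>v i + v i'\<close> in both slots gives 0, and
    expanding leaves just the two mixed values.\<close>
  have transp: "\<Phi> (v \<circ> transpose i i') = - \<Phi> v" if i: "i < N" "i' < N" "i \<noteq> i'" for i i' v
  proof -
    define V where "V a b = \<Phi> (v(i := a, i' := b))" for a b
    have addl: "V (\<lambda>p. a p + a' p) b = V a b + V a' b" for a a' b
      using add[OF i(1), of "v(i' := b)" a a'] i by (simp add: V_def fun_upd_twist)
    have addr: "V a (\<lambda>p. b p + b' p) = V a b + V a b'" for a b b'
      using add[OF i(2), of "v(i := a)" b b'] by (simp add: V_def)
    have z: "V a a = 0" for a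
      unfolding V_def using alt[of i i' "v(i := a, i' := a)"] i by simp
    have "V (\<lambda>p. v i p + v i' p) (\<lambda>p. v i p + v i' p) = 0" by (rule z)
    then have "V (v i) (v i') + V (v i') (v i) = 0" unfolding addl addr z by simp
    moreover have "v(i := v i, i' := v i') = v" by simp
    moreover have "v(i := v i', i' := v i) = v \<circ> transpose i i'"
      using i by (auto simp: fun_eq_iff transpose_def)
    ultimately show ?thesis by (simp add: V_def)
  qed
  \<comment> \<open>Only vanishing is tracked, so the sign of the permutation is never
    computed.\<close>
  have perm: "\<Phi> (v \<circ> p) = 0 \<longleftrightarrow> \<Phi> v = 0" if "p permutes {..<N}" for p v
  proof -
    have "\<forall>v. \<Phi> (v \<circ> p) = 0 \<longleftrightarrow> \<Phi> v = 0"
      using that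
    proof (induction p rule: permutes_induct[OF _ finite_lessThan, consumes 1, case_names id swap])
      case (swap a b p)
      have "\<Phi> (v \<circ> (transpose a b \<circ> p)) = 0 \<longleftrightarrow> \<Phi> (v \<circ> transpose a b) = 0" for v
        unfolding o_assoc using swap by blast
      moreover have "\<Phi> (v \<circ> transpose a b) = 0 \<longleftrightarrow> \<Phi> v = 0" for v
        using swap by (subst transp) auto
      ultimately show ?case by blast
    qed auto
    then show ?thesis by blast
  qed
  have basis: "\<Phi> (\<lambda>i. basis_vec (j i)) = 0" if j: "j ` {..<N} \<subseteq> {..n}" for j
  proof (cases "inj_on j {..<N}")
    case False
    then show ?thesis using alt by (auto simp: inj_on_def)
  next
    case inj: True
    define J where "J = j ` {..<N}"
    have J: "finite J" "card J = N" using inj by (auto simp: J_def card_image)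
    define s where "s i = sorted_list_of_set J ! i" for i
    have mono: "strict_mono_on {..<N} s"
      using J by (auto simp: s_def strict_mono_on_def intro!: sorted_wrt_nth_less[OF strict_sorted_list_of_set])
    have s: "bij_betw s {..<N} J"
      unfolding s_def by (rule bij_betw_nth) (use J in auto)
    \<comment> \<open>\<open>q\<close> sends each position to the place of its index in the sorted
      list; it is extended by the identity, as \<open>permutes\<close> demands.\<close>
    define q where "q i = (if i < N then inv_into {..<N} s (j i) else i)" for i
    have "bij_betw (\<lambda>i. inv_into {..<N} s (j i)) {..<N} {..<N}"
      using bij_betw_trans[OF inj_on_imp_bij_betw[OF inj] bij_betw_inv_into[OF s, unfolded J_def]]
      by (simp add: o_def J_def)
    then have "bij_betw q {..<N} {..<N}"
      by (rule bij_betw_cong[THEN iffD1, rotated]) (simp add: q_def)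
    then have q: "q permutes {..<N}"
      by (rule bij_imp_permutes) (simp add: q_def)
    have "\<Phi> (\<lambda>i. basis_vec (j i)) = \<Phi> ((\<lambda>i. basis_vec (s i)) \<circ> q)"
      using s by (intro cong) (auto simp: q_def J_def bij_betw_def f_inv_into_f)
    then show ?thesis
      using perm[OF q] base[OF mono] s j by (simp add: J_def bij_betw_def)
  qed
  \<comment> \<open>Slots below \<open>k\<close> are arbitrary and the others hold basis vectors;
    each induction step frees one slot, and \<open>k = N\<close> frees all.\<close>
  have "\<forall>v. (\<forall>i. k \<le> i \<and> i < N \<longrightarrow> (\<exists>j\<le>n. v i = basis_vec j)) \<longrightarrow> \<Phi> v = 0" if "k \<le> N" for k
    using that
  proof (induction k)
    case 0
    show ?case
    proof (intro allI impI)
      fix v :: "nat \<Rightarrow> nat \<Rightarrow> real"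
      assume "\<forall>i. 0 \<le> i \<and> i < N \<longrightarrow> (\<exists>j\<le>n. v i = basis_vec j)"
      then obtain j where j: "\<And>i. i < N \<Longrightarrow> j i \<le> n \<and> v i = basis_vec (j i)" by (metis le0)
      then have "\<Phi> v = \<Phi> (\<lambda>i. basis_vec (j i))" by (intro cong) auto
      then show "\<Phi> v = 0" using basis[of j] j by auto
    qed
  next
    case (Suc k)
    show ?case
    proof (intro allI impI)
      fix v :: "nat \<Rightarrow> nat \<Rightarrow> real"
      assume v: "\<forall>i. Suc k \<le> i \<and> i < N \<longrightarrow> (\<exists>j\<le>n. v i = basis_vec j)"
      have "\<Phi> (v(k := basis_vec j)) = 0" if "j \<le> n" for j
      proof -
        have "\<forall>i. k \<le> i \<and> i < N \<longrightarrow> (\<exists>j'\<le>n. (v(k := basis_vec j)) i = basis_vec j')"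
          using v that by (auto simp: Suc_le_eq)
        then show ?thesis using Suc by simp
      qed
      then have "\<Phi> (v(k := v k)) = 0"
        using Suc.prems by (subst expand) auto
      then show "\<Phi> v = 0" by simp
    qed
  qed
  from this[of N] show ?thesis by auto
qed

section \<open>Sums of decomposable two-forms\<close>

definition wed :: "(nat \<Rightarrow> real) \<Rightarrow> (nat \<Rightarrow> real) \<Rightarrow> nat \<Rightarrow> nat \<Rightarrow> real" where
  "wed y z i j = y i * z j - y j * z i"

definition pairsum :: "(nat \<Rightarrow> nat \<Rightarrow> real) \<Rightarrow> nat set \<Rightarrow> nat \<Rightarrow> nat \<Rightarrow> real" where
  "pairsum v K i j = (\<Sum>k\<in>K. wed (v (2 * k)) (v (2 * k + 1)) i j)"

lemma pairsum_remove:
  assumes "finite K" "k \<in> K"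
  shows "pairsum v K = (\<lambda>p q. pairsum v (K - {k}) p q + wed (v (2 * k)) (v (2 * k + 1)) p q)"
  using assms by (auto simp: pairsum_def fun_eq_iff sum.remove)

text \<open>Turns a second factor into a first one, so that slots of either parity are treated
  alike.\<close>

lemma wed_flip: "wed y z = wed z (\<lambda>i. - y i)"
  by (simp add: wed_def fun_eq_iff)

text \<open>The order of quantifiers matters: one partner \<open>a\<close> works for all
  \<open>u\<close>, so the sum depends on the entry of slot \<open>i\<close> in an affine
  way.\<close>

lemma pairsum_slot:
  assumes "finite K" "i div 2 \<in> K"
  shows "\<exists>a. \<forall>u. pairsum (v(i := u)) K = (\<lambda>p q. pairsum v (K - {i div 2}) p q + wed u a p q)"
proof -
  define k where "k = i div 2"
  have rest: "pairsum (v(i := u)) (K - {k}) = pairsum v (K - {k})" for u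
    unfolding pairsum_def k_def by (intro ext sum.cong) auto
  note split = pairsum_remove[OF assms[folded k_def]]
  consider "i = 2 * k" | "i = 2 * k + 1" unfolding k_def by linarith
  then show ?thesis
  proof cases
    case 1
    then show ?thesis
      by (intro exI[of _ "v (2 * k + 1)"]) (simp add: split rest[unfolded 1] flip: k_def)
  next
    case 2
    then show ?thesis
      by (intro exI[of _ "\<lambda>p. - v (2 * k) p"])
        (simp add: split rest[unfolded 2, simplified] wed_flip[of "v (2 * k)"] flip: k_def)
  qed
qed

lemma pairsum_reindex:
  assumes "finite K" "card K = m"
  shows "\<exists>w. pairsum v K = pairsum w {..<m}"
proof -
  obtain h where h: "bij_betw h {..<m} K"
    using ex_bij_betw_nat_finite[OF assms(1)] assms(2) by (auto simp: atLeast0LessThan)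
  have "pairsum v K = pairsum (\<lambda>i. v (2 * h (i div 2) + i mod 2)) {..<m}"
    by (auto simp: pairsum_def fun_eq_iff sum.reindex_bij_betw[OF h, symmetric])
  then show ?thesis by blast
qed

text \<open>A matrix stands for a two-form in \<open>n + 1\<close> variables through its entries
  above the diagonal, so antisymmetry is not imposed on it.\<close>

locale decomposably_affine =
  fixes n :: nat and F :: "(nat \<Rightarrow> nat \<Rightarrow> real) \<Rightarrow> real"
  assumes local: "(\<And>i j. i < j \<Longrightarrow> j \<le> n \<Longrightarrow> M i j = M' i j) \<Longrightarrow> F M = F M'"
    and affine: "real_affine (\<lambda>t. F (\<lambda>i j. M i j + t * wed y z i j))"
begin

text \<open>The vectors of all pairs form one tuple of length \<open>2 * Suc m\<close>. The
  hypothesis on \<open>m\<close> summands provides both linearity in each slot and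
  alternation.\<close>

lemma pairsum_step:
  assumes IH: "\<And>v. F (pairsum v {..<m}) = 0"
    and base: "\<And>s. strict_mono_on {..<2 * Suc m} s \<Longrightarrow> s ` {..<2 * Suc m} \<subseteq> {..n} \<Longrightarrow>
      F (pairsum (\<lambda>i. basis_vec (s i)) {..<Suc m}) = 0"
  shows "F (pairsum v {..<Suc m}) = 0"
proof (rule alternating_vanish[where \<Phi> = "\<lambda>v. F (pairsum v {..<Suc m})" and N = "2 * Suc m" and n = n])
  have zero: "F (pairsum v K) = 0" if "finite K" "card K = m" for v K
    using pairsum_reindex[OF that, of v] IH by auto
  fix i :: nat and v and u :: "nat \<Rightarrow> real"
  assume "i < 2 * Suc m"
  then have i: "i div 2 < Suc m" by auto
  then obtain a where a: "\<And>u. pairsum (v(i := u)) {..<Suc m}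
      = (\<lambda>p q. pairsum v ({..<Suc m} - {i div 2}) p q + wed u a p q)"
    using pairsum_slot[of "{..<Suc m}" i v] by auto
  let ?R = "pairsum v ({..<Suc m} - {i div 2})"
  \<comment> \<open>Without the pair of slot \<open>i\<close> only \<open>m\<close> summands remain.
    The value there is 0, which makes \<open>L\<close> linear and not merely affine.\<close>
  have R: "F ?R = 0" using i by (intro zero) auto
  define L where "L u = F (\<lambda>p q. ?R p q + wed u a p q)" for u
  have "real_affine (\<lambda>t. L (\<lambda>i. u i + t * w i))" for u w
    using affine[of "\<lambda>p q. ?R p q + wed u a p q" w a] by (simp add: L_def wed_def algebra_simps)
  moreover have "L (\<lambda>_. 0) = 0" using R by (simp add: L_def wed_def)
  ultimately have "L (\<lambda>p. \<Sum>j\<in>{..n}. u j * basis_vec j p) = (\<Sum>j\<in>{..n}. u j * L (basis_vec j))"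
    by (intro line_affine_linear) auto
  \<comment> \<open>Coordinates beyond \<open>n\<close> are invisible to \<open>F\<close>, so
    expanding in the first \<open>n + 1\<close> basis vectors suffices.\<close>
  moreover have "L (\<lambda>p. \<Sum>j\<in>{..n}. u j * basis_vec j p) = L u"
    unfolding L_def by (rule local) (simp add: wed_def basis_vec_def if_distrib cong: if_cong)
  ultimately show "F (pairsum (v(i := u)) {..<Suc m}) = (\<Sum>j\<le>n. u j * F (pairsum (v(i := basis_vec j)) {..<Suc m}))"
    by (simp only: a L_def)
next
  have zero: "F (pairsum v K) = 0" if "finite K" "card K = m" for v K
    using pairsum_reindex[OF that, of v] IH by auto
  fix i i' :: nat and v :: "nat \<Rightarrow> nat \<Rightarrow> real"
  assume ii: "i < 2 * Suc m" "i' < 2 * Suc m" "i \<noteq> i'" "v i = v i'"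
  define k k' where "k = i div 2" and "k' = i' div 2"
  have k: "k < Suc m" "k' < Suc m" using ii by (auto simp: k_def k'_def)
  show "F (pairsum v {..<Suc m}) = 0"
  proof (cases "k = k'")
    case True
    then have "i = 2 * k \<and> i' = 2 * k + 1 \<or> i' = 2 * k \<and> i = 2 * k + 1"
      using ii(3) unfolding k_def k'_def by presburger
    then have "v (2 * k + 1) = v (2 * k)" using ii(4) by auto
    then have "pairsum v {..<Suc m} = pairsum v ({..<Suc m} - {k})"
      using k by (auto simp: pairsum_remove[of "{..<Suc m}" k] fun_eq_iff wed_def)
    then show ?thesis using zero[of "{..<Suc m} - {k}" v] k by simp
  next
    case False
    let ?K = "{..<Suc m} - {k}"
    have slot: "\<exists>a. pairsum v K = (\<lambda>p q. pairsum v (K - {l div 2}) p q + wed (v l) a p q)"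
      if "finite K" "l div 2 \<in> K" for K l
      using pairsum_slot[OF that, of v] by (metis fun_upd_triv)
    obtain a where a: "pairsum v {..<Suc m} = (\<lambda>p q. pairsum v ?K p q + wed (v i) a p q)"
      using slot[of "{..<Suc m}" i] k unfolding k_def by blast
    obtain b where b: "pairsum v ?K = (\<lambda>p q. pairsum v (?K - {k'}) p q + wed (v i') b p q)"
      using slot[of ?K i'] k False unfolding k'_def by blast
    \<comment> \<open>The wedges of the common vector with \<open>a\<close> and with
      \<open>b\<close> merge into its wedge with \<open>a + b\<close>. This is stored in pair
      \<open>k\<close>, and pair \<open>k'\<close> is dropped, leaving \<open>m\<close>
      summands.\<close>
    define w where "w = v(2 * k := v i, 2 * k + 1 := \<lambda>p. a p + b p)"
    have w: "pairsum w (?K - {k'}) = pairsum v (?K - {k'})"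
      unfolding pairsum_def w_def by (intro ext sum.cong refl) (auto simp: Suc_double_not_eq_double double_not_eq_Suc_double)
    have set: "{..<Suc m} - {k'} - {k} = ?K - {k'}" by auto
    have "pairsum w ({..<Suc m} - {k'}) = (\<lambda>p q. pairsum w (?K - {k'}) p q + wed (v i) (\<lambda>p. a p + b p) p q)"
      using k False by (auto simp: pairsum_remove[of "{..<Suc m} - {k'}" k] set) (simp add: w_def)
    also have "\<dots> = pairsum v {..<Suc m}"
      using a b ii(4) by (simp add: w wed_def algebra_simps fun_eq_iff)
    finally show ?thesis using zero[of "{..<Suc m} - {k'}" w] k by simp
  qed
next
  fix v v' :: "nat \<Rightarrow> nat \<Rightarrow> real"
  assume "\<And>i. i < 2 * Suc m \<Longrightarrow> v i = v' i"
  then have "pairsum v {..<Suc m} = pairsum v' {..<Suc m}"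
    unfolding pairsum_def by (intro ext sum.cong) auto
  then show "F (pairsum v {..<Suc m}) = F (pairsum v' {..<Suc m})" by simp
qed (use base in auto)

lemma vanish:
  assumes base: "\<And>m s. strict_mono_on {..<2 * m} s \<Longrightarrow> s ` {..<2 * m} \<subseteq> {..n} \<Longrightarrow>
      F (pairsum (\<lambda>i. basis_vec (s i)) {..<m}) = 0"
  shows "F M = 0"
proof -
  have z: "F (pairsum v {..<m}) = 0" for v m
  proof (induction m arbitrary: v)
    case 0
    have "pairsum v {..<0} = pairsum (\<lambda>i. basis_vec (id i)) {..<0}"
      by (simp add: pairsum_def fun_eq_iff)
    then show ?case using base[of 0 id] by (simp add: strict_mono_on_def)
  next
    case (Suc m)
    show ?case by (rule pairsum_step[OF Suc.IH base])
  qed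
  \<comment> \<open>Row decomposition: above the diagonal, \<open>M\<close> is the sum over
    \<open>i\<close> of the \<open>i\<close>-th basis vector wedged with the part of row
    \<open>i\<close> to the right of the diagonal. Rows 0 to \<open>n\<close> give
    \<open>Suc n\<close> summands.\<close>
  define v where "v i = (if even i then basis_vec (i div 2)
    else (\<lambda>j. if i div 2 < j then M (i div 2) j else 0))" for i
  have "pairsum v {..<Suc n} i j = M i j" if ij: "i < j" "j \<le> n" for i j
  proof -
    have "pairsum v {..<Suc n} i j = (\<Sum>k<Suc n. (if k = i then M i j else 0))"
      unfolding pairsum_def using ij by (intro sum.cong) (auto simp: v_def wed_def basis_vec_def)
    then show ?thesis using ij by simp
  qed
  then have "F M = F (pairsum v {..<Suc n})" by (intro local) auto
  then show ?thesis using z by simp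
qed

end

section \<open>Interpolation and the expansion\<close>

definition form1 :: "nat \<Rightarrow> (nat \<Rightarrow> real) \<Rightarrow> form" where
  "form1 n x = (\<lambda>I. if \<exists>i<n. I = {i} then x (the_elem I) else 0)"

text \<open>\<open>Min\<close> and \<open>Max\<close> pick the entry above the diagonal, so
  \<open>W\<close> may be any matrix.\<close>

definition form2 :: "nat \<Rightarrow> (nat \<Rightarrow> nat \<Rightarrow> real) \<Rightarrow> form" where
  "form2 n W = (\<lambda>I. if I \<subseteq> {..<n} \<and> card I = 2 then W (Min I) (Max I) else 0)"

lemma form1_mem_Lambda: "form1 n x \<in> Lambda n 1"
  by (auto simp: form1_def Lambda_def split: if_splits)

lemma form2_mem_Lambda: "form2 n W \<in> Lambda n 2"
  by (auto simp: form2_def Lambda_def split: if_splits)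

lemma form1_affine: "form_add (form1 n x) (form_scale t (form1 n u)) = form1 n (\<lambda>i. x i + t * u i)"
  by (auto simp: form1_def form_add_def form_scale_def fun_eq_iff)

lemma form2_affine: "form_add (form2 n W) (form_scale t (form2 n V)) = form2 n (\<lambda>i j. W i j + t * V i j)"
  by (auto simp: form2_def form_add_def form_scale_def fun_eq_iff)

lemma form1_zero: "form1 n (\<lambda>_. 0) = (\<lambda>_. 0)"
  by (auto simp: form1_def)

lemma form1_cong: "(\<And>i. i < n \<Longrightarrow> x i = y i) \<Longrightarrow> form1 n x = form1 n y"
  by (auto simp: form1_def fun_eq_iff)

lemma card2_less:
  assumes "card (I :: nat set) = 2"
  obtains a b where "a < b" "I = {a, b}" "Min I = a" "Max I = b"
proof -
  obtain a b where "I = {a, b}" "a \<noteq> b" using assms by (auto simp: card_2_iff)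
  then show thesis
    using that[of a b] that[of b a] by (cases "a < b") (auto simp: insert_commute)
qed

lemma form2_cong:
  assumes "\<And>i j. i < j \<Longrightarrow> j < n \<Longrightarrow> V i j = W i j"
  shows "form2 n V = form2 n W"
  unfolding form2_def
proof (intro ext if_cong refl)
  fix I :: "nat set" assume I: "I \<subseteq> {..<n} \<and> card I = 2"
  then obtain a b where "a < b" "I = {a, b}" "Min I = a" "Max I = b" by (auto elim: card2_less)
  then show "V (Min I) (Max I) = W (Min I) (Max I)" using I assms[of a b] by auto
qed

lemma Lambda1_eq_form1: "\<theta> \<in> Lambda n 1 \<Longrightarrow> \<theta> = form1 n (\<lambda>i. \<theta> {i})"
  by (auto simp: Lambda_def form1_def fun_eq_iff card_1_singleton_iff)

lemma Lambda2_eq_form2: "\<omega> \<in> Lambda n 2 \<Longrightarrow> \<omega> = form2 n (\<lambda>i j. \<omega> {i, j})"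
  by (auto simp: Lambda_def form2_def fun_eq_iff elim!: card2_less)

lemma wedge_form1: "wedge (form1 n x) (form1 n u) = form2 n (wed x u)"
proof
  fix I show "wedge (form1 n x) (form1 n u) I = form2 n (wed x u) I"
  proof (cases "I \<subseteq> {..<n} \<and> card I = 2")
    case True
    then obtain a b where ab: "a < b" "I = {a, b}" "Min I = a" "Max I = b" by (auto elim: card2_less)
    have sgn: "shuffle_sign {a} {b} = 1" "shuffle_sign {b} {a} = -1"
    proof -
      have "{(x, y). x \<in> {a} \<and> y \<in> {b} \<and> y < x} = {}"
        and "{(x, y). x \<in> {b} \<and> y \<in> {a} \<and> y < x} = {(b, a)}"
        using ab(1) by auto
      then have "shuffle_sign {a} {b} = (-1) ^ card ({} :: (nat \<times> nat) set)"
        and "shuffle_sign {b} {a} = (-1) ^ card {(b, a)}"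
        unfolding shuffle_sign_def by (simp_all only:)
      then show "shuffle_sign {a} {b} = 1" "shuffle_sign {b} {a} = -1" by simp_all
    qed
    have "I - {a, b} = {}" using ab(2) by auto
    \<comment> \<open>These values remove the empty and the full subset; the two singletons give the
      terms of a 2 by 2 minor.\<close>
    then have ne: "form1 n x {} = 0" "form1 n u (I - {a, b}) = 0" by (auto simp: form1_def)
    have lt: "a < n" "b < n" using True ab by auto
    have Pow: "Pow I = {{}, {a}, {b}, {a, b}}" unfolding ab(2) by auto
    have "I - {a} = {b}" "I - {b} = {a}" "{a} \<noteq> {b}" "{a} \<noteq> {a, b}" "{b} \<noteq> {a, b}"
      using ab(1,2) by auto
    then have "wedge (form1 n x) (form1 n u) I = form1 n x {a} * form1 n u {b} - form1 n x {b} * form1 n u {a}"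
      unfolding wedge_def Pow by (simp add: sgn ne)
    then show ?thesis
      using True ab lt by (simp add: form1_def form2_def wed_def)
  next
    case False
    then show ?thesis
      using wedge_mem_Lambda[OF form1_mem_Lambda[of n x] form1_mem_Lambda[of n u]] form2_mem_Lambda[of n "wed x u"]
      unfolding Lambda_def one_add_one by (metis (mono_tags, lifting) mem_Collect_eq)
  qed
qed

lemma wedge_basis_form1:
  assumes "a < n" "finite I"
  shows "wedge (form1 n (basis_vec a)) \<psi> I
    = (if a \<in> I then shuffle_sign {a} (I - {a}) * \<psi> (I - {a}) else 0)"
proof -
  have "form1 n (basis_vec a) J = (if J = {a} then 1 else 0)" for J
    using assms(1) by (auto simp: form1_def basis_vec_def)
  then have "wedge (form1 n (basis_vec a)) \<psi> I
      = (\<Sum>J\<in>Pow I. if J = {a} then shuffle_sign {a} (I - {a}) * \<psi> (I - {a}) else 0)"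
    unfolding wedge_def by (intro sum.cong) auto
  then show ?thesis using assms(2) by simp
qed

text \<open>An element of the group as the strictly upper triangular part, with indices in \<open>{0..n}\<close>, of a matrix: the
  last column is \<open>\<theta>\<close>.\<close>

definition point :: "nat \<Rightarrow> (nat \<Rightarrow> nat \<Rightarrow> real) \<Rightarrow> form \<times> form" where
  "point n M = (form1 n (\<lambda>i. M i n), form2 n M)"

lemma Fn_eq_point:
  assumes "p \<in> Fn n" obtains M where "p = point n M"
proof
  let ?M = "\<lambda>i j. if j = n then fst p {i} else snd p {i, j}"
  have "fst p = form1 n (\<lambda>i. ?M i n)"
    using assms Lambda1_eq_form1[of "fst p" n] by (simp add: Fn_def mem_Times_iff)
  moreover have "snd p = form2 n ?M"
  proof -
    have "form2 n ?M = form2 n (\<lambda>i j. snd p {i, j})" by (rule form2_cong) auto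
    then show ?thesis
      using assms Lambda2_eq_form2[of "snd p" n] by (simp add: Fn_def mem_Times_iff)
  qed
  ultimately show "p = point n ?M" by (simp add: point_def prod_eq_iff)
qed

text \<open>The last column of the wedge of \<open>y\<close> and \<open>z\<close> is the first-layer
  direction \<open>u\<close>. If \<open>z n\<close> or \<open>y n\<close> is nonzero, that wedge
  equals the wedge of \<open>u\<close> with a multiple of \<open>z\<close> or of \<open>y\<close>, a
  sheared direction. If both are zero, the direction is vertical.\<close>

lemma h_affine_imp_decomposably_affine:
  assumes "h_affine n f"
  shows "decomposably_affine n (\<lambda>M. f (point n M))"
proof
  fix M M' :: "nat \<Rightarrow> nat \<Rightarrow> real"
  assume "\<And>i j. i < j \<Longrightarrow> j \<le> n \<Longrightarrow> M i j = M' i j"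
  then have "point n M = point n M'"
    unfolding point_def by (intro arg_cong2[where f = Pair] form1_cong form2_cong) auto
  then show "f (point n M) = f (point n M')" by simp
next
  fix M :: "nat \<Rightarrow> nat \<Rightarrow> real" and y z :: "nat \<Rightarrow> real"
  define G where "G x W = f (form1 n x, form2 n W)" for x W
  have hor: "real_affine (\<lambda>t. G (\<lambda>i. x i + t * u i) (\<lambda>i j. W i j + t * (x i * u j - x j * u i)))" for x W u
  proof -
    have "(form1 n x, form2 n W) \<in> Fn n" unfolding Fn_def using form1_mem_Lambda form2_mem_Lambda by blast
    then have "real_affine (\<lambda>t. f (Fmult (form1 n x, form2 n W) (form_scale t (form1 n u), \<lambda>_. 0)))"
      using assms form1_mem_Lambda unfolding h_affine_def real_affine_def by blast
    moreover have "Fmult (form1 n x, form2 n W) (form_scale t (form1 n u), \<lambda>_. 0) =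
        (form1 n (\<lambda>i. x i + t * u i), form2 n (\<lambda>i j. W i j + t * (x i * u j - x j * u i)))" for t
      by (simp add: Fmult_def form_add_zero_right form1_affine wedge_scale_right wedge_form1 form2_affine wed_def)
    ultimately show ?thesis by (simp add: G_def)
  qed
  define u where "u i = y i * z n - y n * z i" for i
  have F: "f (point n (\<lambda>i j. M i j + t * wed y z i j)) = G (\<lambda>i. M i n + t * u i) (\<lambda>i j. M i j + t * wed y z i j)" for t
    by (simp add: G_def point_def wed_def u_def)
  consider "y n = 0 \<and> z n = 0" | "z n \<noteq> 0" | "y n \<noteq> 0" by blast
  then show "real_affine (\<lambda>t. f (point n (\<lambda>i j. M i j + t * wed y z i j)))"
  proof cases
    case 1
    then show ?thesis
      unfolding F
      using horizontal_affine_imp_vertical[of G, OF hor, where x = "\<lambda>i. M i n" and W = M and u = y and b = z]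
      by (simp add: u_def wed_def)
  next
    case 2
    then have "wed y z i j = u i * (z j / z n) - u j * (z i / z n)" for i j
      by (simp add: wed_def u_def field_simps)
    then show ?thesis unfolding F by (simp only:) (rule horizontal_affine_imp_sheared[OF hor])
  next
    case 3
    then have "wed y z i j = u i * (y j / y n) - u j * (y i / y n)" for i j
      by (simp add: wed_def u_def field_simps)
    then show ?thesis unfolding F by (simp only:) (rule horizontal_affine_imp_sheared[OF hor])
  qed
qed

section \<open>Interpolation points indexed by subsets of the basis\<close>

text \<open>The sum of the forms \<open>e\<^bsub>s 0\<^esub> \<and> e\<^bsub>s 1\<^esub>\<close>, \<open>e\<^bsub>s 2\<^esub> \<and> e\<^bsub>s 3\<^esub>\<close>, \<dots>, where for odd \<open>d\<close> the last vector is paired with the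
  extra basis vector \<open>e\<^sub>n\<close>.\<close>

definition chain_point :: "nat \<Rightarrow> (nat \<Rightarrow> nat) \<Rightarrow> nat \<Rightarrow> form \<times> form" where
  "chain_point n s d = (if odd d then form1 n (basis_vec (s (d - 1))) else (\<lambda>_. 0),
     form2 n (pairsum (\<lambda>i. basis_vec (s i)) {..<d div 2}))"

definition set_point :: "nat \<Rightarrow> nat set \<Rightarrow> form \<times> form" where
  "set_point n J = chain_point n (\<lambda>i. sorted_list_of_set J ! i) (card J)"

lemma chain_point_mem: "chain_point n s d \<in> Fn n"
  using form1_mem_Lambda form2_mem_Lambda by (auto simp: chain_point_def Fn_def Lambda_def)

lemma chain_point_eq_set_point:
  assumes "strict_mono_on {..<d} s"
  shows "chain_point n s d = set_point n (s ` {..<d})"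
proof -
  have "inj_on s {..<d}" using assms by (rule strict_mono_on_imp_inj_on)
  then have card: "card (s ` {..<d}) = d" by (simp add: card_image)
  have "sorted_wrt (<) (map s [0..<d])"
    using assms by (auto simp: sorted_wrt_iff_nth_less strict_mono_on_def)
  then have "sorted_list_of_set (s ` {..<d}) = map s [0..<d]"
    by (intro strict_sorted_equal) (auto simp: atLeast0LessThan)
  then have eq: "sorted_list_of_set (s ` {..<d}) ! i = s i" if "i < d" for i
    using that by simp
  have "pairsum (\<lambda>i. basis_vec (s i)) {..<d div 2} =
     pairsum (\<lambda>i. basis_vec (sorted_list_of_set (s ` {..<d}) ! i)) {..<d div 2}"
    unfolding pairsum_def by (intro ext sum.cong) (auto simp: eq)
  moreover have "s (d - 1) = sorted_list_of_set (s ` {..<d}) ! (d - 1)" if "odd d"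
    using that by (subst eq) (auto elim: oddE)
  ultimately show ?thesis
    by (simp add: set_point_def chain_point_def card)
qed

text \<open>An increasing \<open>s\<close> can take the value \<open>n\<close> only at its last
  position \<open>2 * m - 1\<close>. In that case the last wedge contains the extra basis vector and
  becomes the first-layer component, so \<open>d = 2 * m - 1\<close>; otherwise
  \<open>d = 2 * m\<close>.\<close>

lemma point_pairsum:
  assumes s: "strict_mono_on {..<2 * m} s" "s ` {..<2 * m} \<subseteq> {..n}"
  obtains d where "strict_mono_on {..<d} s" "s ` {..<d} \<subseteq> {..<n}"
    "point n (pairsum (\<lambda>i. basis_vec (s i)) {..<m}) = chain_point n s d"
proof (cases "\<exists>i<2 * m. s i = n")
  case False
  then have lt: "s i < n" if "i < 2 * m" for i
    using that s(2) by (metis atMost_iff image_subset_iff lessThan_iff order_le_less)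
  have "form1 n (\<lambda>i. pairsum (\<lambda>i. basis_vec (s i)) {..<m} i n) = form1 n (\<lambda>_. 0)"
  proof (rule form1_cong)
    fix i
    have "basis_vec (s j) n = 0" if "j < 2 * m" for j
      using lt[OF that] by (simp add: basis_vec_def)
    then show "pairsum (\<lambda>i. basis_vec (s i)) {..<m} i n = 0"
      unfolding pairsum_def by (intro sum.neutral ballI) (simp add: wed_def)
  qed
  then show ?thesis
    using lt s by (intro that[of "2 * m"]) (auto simp: point_def chain_point_def form1_zero)
next
  case True
  then obtain i where i: "i < 2 * m" "s i = n" by blast
  have mono: "s j < s k" if "j < k" "k < 2 * m" for j k
    using s(1) that by (auto simp: strict_mono_on_def)
  have "i = 2 * m - 1"
  proof (rule ccontr)
    assume "i \<noteq> 2 * m - 1"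
    then have "n < s (2 * m - 1)" "2 * m - 1 < 2 * m" using mono[of i "2 * m - 1"] i by auto
    then show False using s(2) by (metis atMost_iff image_subset_iff lessThan_iff linorder_not_less)
  qed
  then obtain k where k: "m = Suc k" "s (2 * k + 1) = n" using i by (cases m) auto
  have lt: "s j < n" if "j < 2 * k + 1" for j
    using mono[of j "2 * k + 1"] that k by simp
  let ?b = "\<lambda>i. basis_vec (s i)"
  have split: "pairsum ?b {..<m} p q = pairsum ?b {..<k} p q + wed (?b (2 * k)) (?b (2 * k + 1)) p q" for p q
    by (simp add: pairsum_def k(1))
  have "form1 n (\<lambda>i. pairsum ?b {..<m} i n) = form1 n (?b (2 * k))"
  proof (rule form1_cong)
    fix i assume "i < n"
    have z: "basis_vec (s j) n = 0" if "j < 2 * k + 1" for j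
      using lt[OF that] by (simp add: basis_vec_def)
    have "pairsum ?b {..<k} i n = 0"
      unfolding pairsum_def by (intro sum.neutral ballI) (simp add: wed_def z)
    then show "pairsum ?b {..<m} i n = ?b (2 * k) i"
      using \<open>i < n\<close> z k(2) by (simp add: split wed_def basis_vec_def)
  qed
  moreover have "form2 n (pairsum ?b {..<m}) = form2 n (pairsum ?b {..<k})"
    using k(2) by (intro form2_cong) (simp add: split wed_def basis_vec_def)
  ultimately have "point n (pairsum ?b {..<m}) = chain_point n s (2 * k + 1)"
    by (simp add: point_def chain_point_def)
  moreover have "strict_mono_on {..<2 * k + 1} s"
    using s(1) k(1) by (auto simp: strict_mono_on_def)
  ultimately show ?thesis using lt by (intro that) auto
qed

lemma h_affine_vanish:
  assumes f: "h_affine n f" and zero: "\<And>J. J \<subseteq> {..<n} \<Longrightarrow> f (set_point n J) = 0" and p: "p \<in> Fn n"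
  shows "f p = 0"
proof -
  interpret decomposably_affine n "\<lambda>M. f (point n M)"
    by (rule h_affine_imp_decomposably_affine[OF f])
  obtain M where "p = point n M" using Fn_eq_point[OF p] by blast
  moreover have "f (point n M) = 0"
  proof (rule vanish)
    fix m :: nat and s :: "nat \<Rightarrow> nat"
    assume "strict_mono_on {..<2 * m} s" "s ` {..<2 * m} \<subseteq> {..n}"
    then obtain d where "strict_mono_on {..<d} s" "s ` {..<d} \<subseteq> {..<n}"
      "point n (pairsum (\<lambda>i. basis_vec (s i)) {..<m}) = chain_point n s d"
      by (rule point_pairsum)
    then show "f (point n (pairsum (\<lambda>i. basis_vec (s i)) {..<m})) = 0"
      using zero by (simp add: chain_point_eq_set_point)
  qed
  ultimately show ?thesis by simp
qed

section \<open>Supports and leading coefficients at the interpolation points\<close>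

definition supported :: "nat set \<Rightarrow> form \<Rightarrow> bool" where
  "supported A \<alpha> \<longleftrightarrow> (\<forall>I. \<alpha> I \<noteq> 0 \<longrightarrow> I \<subseteq> A)"

lemma supported_wedge:
  assumes "supported A \<alpha>" "supported A \<beta>"
  shows "supported A (wedge \<alpha> \<beta>)"
  unfolding supported_def
proof (intro allI impI)
  fix I assume "wedge \<alpha> \<beta> I \<noteq> 0"
  then obtain J where "J \<subseteq> I" "\<alpha> J \<noteq> 0" "\<beta> (I - J) \<noteq> 0"
    unfolding wedge_def by (auto elim!: sum.not_neutral_contains_not_neutral)
  then show "I \<subseteq> A" using assms unfolding supported_def by blast
qed

lemma supported_wpow: "supported A \<omega> \<Longrightarrow> supported A (wpow \<omega> k)"
  by (induction k) (auto simp: supported_wedge, auto simp: supported_def form_one_def split: if_splits)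

lemma supported_weight_form: "supported A (fst p) \<Longrightarrow> supported A (snd p) \<Longrightarrow> supported A (weight_form d p)"
  by (simp add: weight_form_def supported_wedge supported_wpow)

lemma supported_form2_pairsum:
  assumes "s ` {..<2 * m} \<subseteq> A"
  shows "supported A (form2 n (pairsum (\<lambda>i. basis_vec (s i)) {..<m}))"
  unfolding supported_def
proof (intro allI impI)
  fix I assume nz: "form2 n (pairsum (\<lambda>i. basis_vec (s i)) {..<m}) I \<noteq> 0"
  then have "card I = 2" by (auto simp: form2_def split: if_splits)
  then obtain a b where ab: "I = {a, b}" "Min I = a" "Max I = b" by (auto elim: card2_less)
  then have "pairsum (\<lambda>i. basis_vec (s i)) {..<m} a b \<noteq> 0"
    using nz by (auto simp: form2_def split: if_splits)
  then obtain k where k: "k < m" "wed (basis_vec (s (2 * k))) (basis_vec (s (2 * k + 1))) a b \<noteq> 0"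
    unfolding pairsum_def by (auto elim!: sum.not_neutral_contains_not_neutral)
  then have "{a, b} = {s (2 * k), s (2 * k + 1)}"
    by (auto simp: wed_def basis_vec_def split: if_splits)
  moreover have "s (2 * k) \<in> A" "s (2 * k + 1) \<in> A" using assms k(1) by auto
  ultimately show "I \<subseteq> A" using ab by auto
qed

lemma supported_chain_point:
  assumes "s ` {..<d} \<subseteq> A"
  shows "supported A (weight_form e (chain_point n s d))"
proof (rule supported_weight_form)
  show "supported A (snd (chain_point n s d))"
    using assms by (auto simp: chain_point_def intro!: supported_form2_pairsum)
  have "s (d - 1) \<in> A" if "odd d"
    using assms odd_pos[OF that] by (auto simp: image_subset_iff)
  then show "supported A (fst (chain_point n s d))"
    by (auto simp: chain_point_def supported_def form1_def basis_vec_def split: if_splits)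
qed

text \<open>The coefficient is the factorial of \<open>m\<close> up to sign. A new pair
  \<open>\<delta>\<close> contributes \<open>Suc m\<close> times its wedge with the
  \<open>m\<close>-th power of \<open>\<omega>\<close>; the power of \<open>\<omega>\<close> alone
  is supported on the old indices and misses the enlarged set.\<close>

lemma wpow_pairsum_top:
  assumes "inj_on s {..<2 * m}" "s ` {..<2 * m} \<subseteq> {..<n}"
  shows "wpow (form2 n (pairsum (\<lambda>i. basis_vec (s i)) {..<m})) m (s ` {..<2 * m}) \<noteq> 0"
  using assms
proof (induction m)
  case 0
  then show ?case by (simp add: form_one_def)
next
  case (Suc m)
  define \<epsilon> where "\<epsilon> i = form1 n (basis_vec (s i))" for i
  define \<omega> where "\<omega> = form2 n (pairsum (\<lambda>i. basis_vec (s i)) {..<m})"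
  define \<delta> where "\<delta> = wedge (\<epsilon> (2 * m)) (\<epsilon> (2 * m + 1))"
  let ?J = "s ` {..<2 * m}" and ?J' = "s ` {..<2 * Suc m}"
  have J': "?J' = insert (s (2 * m)) (insert (s (2 * m + 1)) ?J)"
    by (auto simp: lessThan_Suc)
  have J: "s (2 * m) \<notin> ?J" "s (2 * m + 1) \<notin> ?J" "s (2 * m) \<noteq> s (2 * m + 1)"
    by (auto simp: inj_on_eq_iff[OF Suc.prems(1)])
  have lt: "s (2 * m) < n" "s (2 * m + 1) < n" "?J \<subseteq> {..<n}" using Suc.prems(2) by (auto simp: image_subset_iff)
  have IH: "wpow \<omega> m ?J \<noteq> 0"
    unfolding \<omega>_def using Suc.prems by (intro Suc.IH) (auto simp: inj_on_def image_subset_iff)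
  have "supported ?J (wpow \<omega> (Suc m))"
    unfolding \<omega>_def by (intro supported_wpow supported_form2_pairsum) simp
  then have z: "wpow \<omega> (Suc m) ?J' = 0"
    using J unfolding supported_def J' by blast
  have "form2 n (pairsum (\<lambda>i. basis_vec (s i)) {..<Suc m}) = form_add \<omega> (form_scale 1 \<delta>)"
    unfolding \<omega>_def \<delta>_def \<epsilon>_def wedge_form1 form2_affine
    by (intro form2_cong) (simp add: pairsum_def)
  moreover have "wedge \<delta> \<delta> = (\<lambda>_. 0)"
    unfolding \<delta>_def \<epsilon>_def by (rule wedge_decomposable_square[OF form1_mem_Lambda form1_mem_Lambda])
  moreover have "wedge \<omega> \<delta> = wedge \<delta> \<omega>"
    unfolding \<omega>_def \<delta>_def \<epsilon>_def wedge_form1 by (rule Lambda_commute2[OF form2_mem_Lambda form2_mem_Lambda])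
  ultimately have "wpow (form2 n (pairsum (\<lambda>i. basis_vec (s i)) {..<Suc m})) (Suc m) ?J'
      = real (Suc m) * wedge \<delta> (wpow \<omega> m) ?J'"
    using z by (simp only: wpow_add_square_zero) (simp add: form_add_def form_scale_def)
  moreover have "?J' - {s (2 * m)} - {s (2 * m + 1)} = ?J"
    using J unfolding J' by auto
  then have "wedge \<delta> (wpow \<omega> m) ?J' \<noteq> 0"
    unfolding \<delta>_def \<epsilon>_def wedge_assoc using lt J IH
    by (simp add: wedge_basis_form1 shuffle_sign_nonzero J')
  ultimately show ?case by simp
qed

lemma weight_form_chain_point_top:
  assumes "inj_on s {..<d}" "s ` {..<d} \<subseteq> {..<n}"
  shows "weight_form d (chain_point n s d) (s ` {..<d}) \<noteq> 0"
proof (cases "even d")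
  case True
  then show ?thesis
    using wpow_pairsum_top[of s "d div 2" n] assms by (simp add: weight_form_def chain_point_def)
next
  case False
  then obtain m where d: "d = 2 * m + 1" by (rule oddE)
  have J: "s ` {..<d} = insert (s (2 * m)) (s ` {..<2 * m})" "s (2 * m) \<notin> s ` {..<2 * m}"
    using assms(1) by (auto simp: d lessThan_Suc inj_on_def)
  have "s (2 * m) < n" using assms(2) by (auto simp: d)
  moreover have "wpow (form2 n (pairsum (\<lambda>i. basis_vec (s i)) {..<m})) m (s ` {..<2 * m}) \<noteq> 0"
    using assms by (intro wpow_pairsum_top) (auto simp: d inj_on_def image_subset_iff)
  ultimately show ?thesis
    using J(2) by (simp add: J(1)) (simp add: d weight_form_def chain_point_def wedge_basis_form1 shuffle_sign_nonzero)
qed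

lemma sorted_list_of_set_nth:
  assumes "finite (J :: nat set)"
  shows "inj_on (\<lambda>i. sorted_list_of_set J ! i) {..<card J}"
    "(\<lambda>i. sorted_list_of_set J ! i) ` {..<card J} = J"
  using bij_betw_nth[of "sorted_list_of_set J" "{..<card J}" J] assms by (auto simp: bij_betw_def)

lemma set_point_mem: "set_point n J \<in> Fn n"
  by (simp add: set_point_def chain_point_mem)

lemma weight_form_set_point_top:
  assumes "J \<subseteq> {..<n}"
  shows "weight_form (card J) (set_point n J) J \<noteq> 0"
proof -
  have "finite J" using assms finite_subset by blast
  from sorted_list_of_set_nth[OF this] show ?thesis
    using weight_form_chain_point_top[of "\<lambda>i. sorted_list_of_set J ! i" "card J" n] assms
    by (simp add: set_point_def)
qed

lemma weight_form_set_point_support: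
  assumes "J \<subseteq> {..<n}" "weight_form d (set_point n J) K \<noteq> 0"
  shows "K \<subseteq> J" "card K = d"
proof -
  have "finite J" using assms finite_subset by blast
  from sorted_list_of_set_nth(2)[OF this]
  have "supported J (weight_form d (set_point n J))"
    unfolding set_point_def by (intro supported_chain_point) auto
  then show "K \<subseteq> J" using assms(2) by (simp add: supported_def)
  show "card K = d"
    using weight_form_mem_Lambda[OF set_point_mem, of d n J] assms(2) by (simp add: Lambda_def)
qed

text \<open>This is the triangularity. Weights above \<open>card J\<close> would need index sets
  larger than \<open>J\<close>, and weight \<open>card J\<close> sees only the coefficient of
  \<open>\<beta>\<close> at the complement of \<open>J\<close>.\<close>

lemma wedge_weight_form_set_point:
  assumes J: "J \<subseteq> {..<n}" and "card J \<le> d"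
  shows "wedge (weight_form d (set_point n J)) \<beta> {..<n} = (if card J = d
    then shuffle_sign J ({..<n} - J) * weight_form d (set_point n J) J * \<beta> ({..<n} - J) else 0)"
proof -
  have fin: "finite J" using J finite_subset by blast
  have "weight_form d (set_point n J) K = 0" if "K \<noteq> J \<or> card J \<noteq> d" for K
  proof (rule ccontr)
    assume "weight_form d (set_point n J) K \<noteq> 0"
    note K = weight_form_set_point_support[OF J this]
    then have "card K = card J" using assms(2) card_mono[OF fin K(1)] by auto
    then have "K = J" using K(1) fin by (intro card_subset_eq)
    then show False using that K by auto
  qed
  then have "wedge (weight_form d (set_point n J)) \<beta> {..<n} = (\<Sum>K\<in>Pow {..<n}. if K = J then (if card J = d
    then shuffle_sign J ({..<n} - J) * weight_form d (set_point n J) J * \<beta> ({..<n} - J) else 0) else 0)"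
    unfolding wedge_def by (intro sum.cong) auto
  then show ?thesis using J by simp
qed

lemma form_add_apply: "form_add \<alpha> \<beta> I = \<alpha> I + \<beta> I"
  by (simp add: form_add_def)

lemma form_scale_apply: "form_scale c \<alpha> I = c * \<alpha> I"
  by (simp add: form_scale_def)

section \<open>Existence and uniqueness of the coefficients\<close>

definition expansion :: "nat \<Rightarrow> (nat \<Rightarrow> form) \<Rightarrow> form \<times> form \<Rightarrow> real" where
  "expansion n \<eta> p = (\<Sum>d\<le>n. wedge (weight_form d p) (\<eta> (n - d)) {..<n})"

lemma expansion_add: "expansion n (\<lambda>k. form_add (\<eta> k) (\<zeta> k)) p = expansion n \<eta> p + expansion n \<zeta> p"
  by (simp add: expansion_def wedge_add_right form_add_apply sum.distrib)

lemma expansion_scale: "expansion n (\<lambda>k. form_scale c (\<eta> k)) p = c * expansion n \<eta> p"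
  by (simp add: expansion_def wedge_scale_right form_scale_apply sum_distrib_left)

lemma h_affine_expansion: "h_affine n (expansion n \<eta>)"
  unfolding h_affine_def
proof (intro ballI)
  fix p u assume pu: "p \<in> Fn n" "u \<in> Lambda n 1"
  then obtain \<psi> where \<psi>: "\<And>d t. weight_form d (Fmult p (form_scale t u, \<lambda>_. 0)) = form_add (weight_form d p) (form_scale t (\<psi> d))"
    using weight_form_horizontal_affine[OF pu] by metis
  have "expansion n \<eta> (Fmult p (form_scale t u, \<lambda>_. 0))
      = expansion n \<eta> p + (\<Sum>d\<le>n. wedge (\<psi> d) (\<eta> (n - d)) {..<n}) * t" for t
    by (simp add: expansion_def \<psi> wedge_add_left wedge_scale_left form_add_apply form_scale_apply
        sum.distrib sum_distrib_left mult.commute[of _ t])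
  then show "\<exists>a b. \<forall>t. expansion n \<eta> (Fmult p (form_scale t u, \<lambda>_. 0)) = a + b * t" by blast
qed

lemma h_affine_diff:
  assumes "h_affine n f" "h_affine n g"
  shows "h_affine n (\<lambda>p. f p - g p)"
  unfolding h_affine_def
proof (intro ballI)
  fix p u assume "p \<in> Fn n" "u \<in> Lambda n 1"
  then obtain a b c d where "\<forall>t. f (Fmult p (form_scale t u, \<lambda>_. 0)) = a + b * t"
      "\<forall>t. g (Fmult p (form_scale t u, \<lambda>_. 0)) = c + d * t"
    using assms unfolding h_affine_def by blast
  then show "\<exists>a b. \<forall>t. f (Fmult p (form_scale t u, \<lambda>_. 0)) - g (Fmult p (form_scale t u, \<lambda>_. 0)) = a + b * t"
    by (intro exI[of _ "a - c"] exI[of _ "b - d"]) (simp add: algebra_simps)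
qed

text \<open>Forward substitution: stage \<open>d\<close> changes only the component of degree
  \<open>n - d\<close>. This does not affect the values at smaller subsets, and at each subset of
  size \<open>d\<close> it leaves one equation in one unknown with nonzero factor.\<close>

lemma expansion_interpolate:
  assumes "d \<le> Suc n"
  shows "\<exists>\<eta>. (\<forall>k. \<eta> k \<in> Lambda n k) \<and>
    (\<forall>J\<subseteq>{..<n}. card J < d \<longrightarrow> expansion n \<eta> (set_point n J) = f (set_point n J))"
  using assms
proof (induction d)
  case 0
  show ?case by (intro exI[of _ "\<lambda>_ _. 0"]) (simp add: Lambda_def)
next
  case (Suc d)
  then obtain \<eta> where \<eta>: "\<And>k. \<eta> k \<in> Lambda n k"
    "\<And>J. J \<subseteq> {..<n} \<Longrightarrow> card J < d \<Longrightarrow> expansion n \<eta> (set_point n J) = f (set_point n J)"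
    by auto
  \<comment> \<open>The coefficient at \<open>I\<close> is the error at the complement
    \<open>J\<close>, divided by the factor with which that coefficient enters the expansion
    there.\<close>
  define \<zeta> :: "nat \<Rightarrow> form" where "\<zeta> k I = (if k = n - d \<and> I \<subseteq> {..<n} \<and> card I = n - d then
     (let J = {..<n} - I in (f (set_point n J) - expansion n \<eta> (set_point n J)) /
       (shuffle_sign J I * weight_form d (set_point n J) J)) else 0)" for k I
  have z: "expansion n \<zeta> p = wedge (weight_form d p) (\<zeta> (n - d)) {..<n}" for p
  proof -
    have "\<zeta> (n - e) = (\<lambda>_. 0)" if "e \<le> n" "e \<noteq> d" for e
    proof -
      \<comment> \<open>Truncated subtraction does no harm here, as both \<open>e\<close> and
        \<open>d\<close> are at most \<open>n\<close>.\<close>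
      have "n - e \<noteq> n - d" using that Suc.prems by linarith
      then show ?thesis by (simp add: \<zeta>_def fun_eq_iff)
    qed
    then have "expansion n \<zeta> p = (\<Sum>e\<le>n. if e = d then wedge (weight_form d p) (\<zeta> (n - d)) {..<n} else 0)"
      unfolding expansion_def by (intro sum.cong) (auto simp: wedge_zero_right)
    then show ?thesis using Suc.prems by simp
  qed
  show ?case
  proof (intro exI[of _ "\<lambda>k. form_add (\<eta> k) (\<zeta> k)"] conjI allI impI)
    fix k
    have "\<zeta> k \<in> Lambda n k" by (auto simp: \<zeta>_def Lambda_def)
    then show "form_add (\<eta> k) (\<zeta> k) \<in> Lambda n k" using \<eta>(1) by (rule form_add_mem_Lambda[rotated])
  next
    fix J assume J: "J \<subseteq> {..<n}" "card J < Suc d"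
    show "expansion n (\<lambda>k. form_add (\<eta> k) (\<zeta> k)) (set_point n J) = f (set_point n J)"
    proof (cases "card J = d")
      case True
      have "finite J" using J(1) finite_subset by blast
      then have "card ({..<n} - J) = n - d" "{..<n} - ({..<n} - J) = J"
        using J(1) True by (auto simp: card_Diff_subset)
      then have "\<zeta> (n - d) ({..<n} - J) = (f (set_point n J) - expansion n \<eta> (set_point n J)) /
         (shuffle_sign J ({..<n} - J) * weight_form d (set_point n J) J)"
        by (simp add: \<zeta>_def)
      then show ?thesis
        unfolding expansion_add z using J True weight_form_set_point_top[OF J(1)]
        by (simp add: wedge_weight_form_set_point shuffle_sign_nonzero)
    next
      case False
      then show ?thesis
        unfolding expansion_add z using J \<eta>(2) by (simp add: wedge_weight_form_set_point)
    qed
  qed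
qed

text \<open>Interpolating at all subsets leaves a horizontally affine remainder that is zero at
  every interpolation point, hence on the whole group.\<close>

lemma h_affine_imp_expansion:
  assumes "h_affine n f"
  obtains \<eta> where "\<And>k. \<eta> k \<in> Lambda n k" "\<And>p. p \<in> Fn n \<Longrightarrow> f p = expansion n \<eta> p"
proof -
  obtain \<eta> where \<eta>: "\<And>k. \<eta> k \<in> Lambda n k"
    "\<And>J. J \<subseteq> {..<n} \<Longrightarrow> card J < Suc n \<Longrightarrow> expansion n \<eta> (set_point n J) = f (set_point n J)"
    using expansion_interpolate[of "Suc n" n f] by auto
  have "f (set_point n J) - expansion n \<eta> (set_point n J) = 0" if "J \<subseteq> {..<n}" for J
    using \<eta>(2)[OF that] card_mono[OF _ that] by simp
  then have "f p - expansion n \<eta> p = 0" if "p \<in> Fn n" for p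
    using h_affine_vanish[OF h_affine_diff[OF assms h_affine_expansion], of \<eta> p] that by blast
  then show thesis using \<eta>(1) that[of \<eta>] by simp
qed

text \<open>A nonzero coefficient at \<open>I\<close> would be detected at the point of the
  complement of \<open>I\<close>: lower weights drop out by induction and higher ones by
  triangularity.\<close>

lemma expansion_eq_zero:
  assumes \<eta>: "\<And>k. \<eta> k \<in> Lambda n k" and zero: "\<And>p. p \<in> Fn n \<Longrightarrow> expansion n \<eta> p = 0"
  shows "\<eta> k = (\<lambda>_. 0)"
proof -
  have "\<eta> (n - d) = (\<lambda>_. 0)" if "d \<le> n" for d
    using that
  proof (induction d rule: less_induct)
    case (less d)
    show ?case
    proof (rule ext, rule ccontr)
      fix I assume nz: "\<eta> (n - d) I \<noteq> 0"
      then have I: "I \<subseteq> {..<n}" "card I = n - d" using \<eta>[of "n - d"] by (auto simp: Lambda_def)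
      define J where "J = {..<n} - I"
      have J: "J \<subseteq> {..<n}" "{..<n} - J = I" using I by (auto simp: J_def)
      have "card J = n - (n - d)"
        unfolding J_def using I finite_subset[OF I(1)] by (simp add: card_Diff_subset)
      then have card: "card J = d" using less.prems by simp
      have "0 = expansion n \<eta> (set_point n J)" by (simp add: zero set_point_mem)
      also have "\<dots> = (\<Sum>e\<le>n. if e = d then shuffle_sign J I * weight_form d (set_point n J) J * \<eta> (n - d) I else 0)"
        unfolding expansion_def
      proof (intro sum.cong refl)
        fix e assume "e \<in> {..n}"
        then show "wedge (weight_form e (set_point n J)) (\<eta> (n - e)) {..<n} =
          (if e = d then shuffle_sign J I * weight_form d (set_point n J) J * \<eta> (n - d) I else 0)"
          using less.IH[of e] J card
          by (cases "e < d") (auto simp: wedge_zero_right wedge_weight_form_set_point)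
      qed
      also have "\<dots> = shuffle_sign J I * weight_form d (set_point n J) J * \<eta> (n - d) I"
        using less.prems by simp
      finally show False
        using nz weight_form_set_point_top[OF J(1)] card by (simp add: shuffle_sign_nonzero)
    qed
  qed
  from this[of "n - k"] show ?thesis
  proof (cases "k \<le> n")
    case False
    \<comment> \<open>Beyond degree \<open>n\<close> there are no index sets, so the form is
      zero.\<close>
    have "card I \<le> n" if "I \<subseteq> {..<n}" for I using card_mono[OF _ that] by simp
    then have "\<eta> k I = 0" for I using \<eta>[of k] False unfolding Lambda_def by blast
    then show ?thesis by blast
  qed simp
qed

section \<open>Top-degree forms and the passage to the stated formula\<close>

lemma Lambda_top: "\<alpha> \<in> Lambda n n \<Longrightarrow> \<alpha> = form_scale (\<alpha> {..<n}) (vol n)"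
proof
  fix I assume "\<alpha> \<in> Lambda n n"
  then have "\<alpha> I = 0" if "I \<noteq> {..<n}"
    using that card_subset_eq[OF finite_lessThan, of I n] by (auto simp: Lambda_def)
  then show "\<alpha> I = form_scale (\<alpha> {..<n}) (vol n) I"
    by (simp add: form_scale_def vol_def)
qed

text \<open>For \<open>n = 0\<close> truncated subtraction would leave the spurious term
  \<open>g 1\<close>, hence the assumption.\<close>

lemma sum_even_odd:
  fixes g :: "nat \<Rightarrow> 'a::comm_monoid_add"
  assumes "n \<ge> 1"
  shows "(\<Sum>k\<le>n div 2. g (2 * k)) + (\<Sum>k\<le>(n - 1) div 2. g (2 * k + 1)) = (\<Sum>d\<le>n. g d)"
proof -
  have "{..n} = (\<lambda>k. 2 * k) ` {..n div 2} \<union> (\<lambda>k. 2 * k + 1) ` {..(n - 1) div 2}"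
  proof (intro equalityI subsetI)
    fix d assume "d \<in> {..n}"
    then show "d \<in> (\<lambda>k. 2 * k) ` {..n div 2} \<union> (\<lambda>k. 2 * k + 1) ` {..(n - 1) div 2}"
      by (cases "even d") (auto elim!: evenE oddE)
  qed (use assms in auto)
  moreover have "sum g \<dots> = sum g ((\<lambda>k. 2 * k) ` {..n div 2}) + sum g ((\<lambda>k. 2 * k + 1) ` {..(n - 1) div 2})"
    by (rule sum.union_disjoint) (auto, presburger)
  ultimately show ?thesis
    by (simp add: sum.reindex inj_on_def)
qed

lemma weight_form_even: "weight_form (2 * k) p = wpow (snd p) k"
  by (simp add: weight_form_def)

lemma weight_form_odd: "weight_form (2 * k + 1) p = wedge (fst p) (wpow (snd p) k)"
  by (simp add: weight_form_def)

lemma wedge_weight_form_top: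
  assumes "p \<in> Fn n" "\<eta> (n - d) \<in> Lambda n (n - d)" "d \<le> n"
  shows "wedge (weight_form d p) (\<eta> (n - d)) = form_scale (wedge (weight_form d p) (\<eta> (n - d)) {..<n}) (vol n)"
proof (rule Lambda_top)
  show "wedge (weight_form d p) (\<eta> (n - d)) \<in> Lambda n n"
    using wedge_mem_Lambda[OF weight_form_mem_Lambda[OF assms(1), of d] assms(2)] assms(3) by simp
qed

text \<open>All terms have degree \<open>n\<close>, so the identity of forms amounts to the identity
  of their coefficients at \<open>{..<n}\<close>.\<close>

lemma represents_iff_expansion:
  assumes "n \<ge> 1"
  shows "represents n f \<eta> \<longleftrightarrow> (\<forall>k. \<eta> k \<in> Lambda n k) \<and> (\<forall>p\<in>Fn n. f p = expansion n \<eta> p)"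
proof -
  have "form_scale (f p) (vol n) = (\<lambda>I. (\<Sum>k\<le>n div 2. wedge (wpow (snd p) k) (\<eta> (n - 2*k)) I)
      + (\<Sum>k\<le>(n - 1) div 2. wedge (fst p) (wedge (wpow (snd p) k) (\<eta> (n - 2*k - 1))) I))
      \<longleftrightarrow> f p = expansion n \<eta> p" if p: "p \<in> Fn n" and \<eta>: "\<forall>k. \<eta> k \<in> Lambda n k" for p
  proof -
    have "(\<Sum>k\<le>n div 2. wedge (wpow (snd p) k) (\<eta> (n - 2*k)) I)
      + (\<Sum>k\<le>(n - 1) div 2. wedge (fst p) (wedge (wpow (snd p) k) (\<eta> (n - 2*k - 1))) I)
      = (\<Sum>d\<le>n. wedge (weight_form d p) (\<eta> (n - d)) I)" for I
      unfolding sum_even_odd[OF assms, symmetric] weight_form_even weight_form_odd wedge_assoc by simp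
    also have "(\<Sum>d\<le>n. wedge (weight_form d p) (\<eta> (n - d)) I) = expansion n \<eta> p * vol n I" for I
      unfolding expansion_def sum_distrib_right
      using wedge_weight_form_top[OF p, of \<eta>] \<eta> by (intro sum.cong refl) (metis atMost_iff form_scale_def)
    finally show ?thesis by (auto simp: form_scale_def fun_eq_iff vol_def)
  qed
  then show ?thesis
    unfolding represents_def by (auto; force)
qed

theorem theorem1p1:
  fixes n :: nat and f :: "form \<times> form \<Rightarrow> real"
  assumes "n \<ge> 2"
  shows "(h_affine n f \<longleftrightarrow> (\<exists>\<eta>. represents n f \<eta>))
    \<and> (h_affine n f \<longrightarrow> (\<exists>!\<eta>. represents n f \<eta>))
    \<and> (\<forall>\<eta>. represents n f \<eta> \<longrightarrow>
         (\<forall>\<theta> \<omega>. (\<theta>, \<omega>) \<in> Fn n \<longrightarrow>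
           (\<exists>p :: real poly. degree p \<le> n
              \<and> (\<forall>t>0. f (dil t (\<theta>, \<omega>)) = poly p t)
              \<and> (\<forall>k\<le>n div 2. wedge (wpow \<omega> k) (\<eta> (n - 2*k))
                               = form_scale (coeff p (2*k)) (vol n))
              \<and> (\<forall>k\<le>(n - 1) div 2. wedge \<theta> (wedge (wpow \<omega> k) (\<eta> (n - 2*k - 1)))
                               = form_scale (coeff p (2*k+1)) (vol n)))))"
proof (intro conjI impI allI)
  have n: "n \<ge> 1" using assms by simp
  note rep = represents_iff_expansion[OF n]
  show ex: "h_affine n f \<longleftrightarrow> (\<exists>\<eta>. represents n f \<eta>)"
  proof
    assume "h_affine n f"
    then show "\<exists>\<eta>. represents n f \<eta>" unfolding rep by (metis h_affine_imp_expansion)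
  next
    assume "\<exists>\<eta>. represents n f \<eta>"
    then obtain \<eta> where \<eta>: "\<And>p. p \<in> Fn n \<Longrightarrow> f p = expansion n \<eta> p" unfolding rep by blast
    \<comment> \<open>A horizontal line that starts in the group stays in it, so \<open>f\<close>
      agrees with its expansion along the whole line.\<close>
    have "Fmult p (form_scale t u, \<lambda>_. 0) \<in> Fn n" if "p \<in> Fn n" "u \<in> Lambda n 1" for p t u
    proof -
      have "wedge (fst p) u \<in> Lambda n 2"
        using wedge_mem_Lambda[of "fst p" n 1 u 1] that unfolding Fn_def mem_Times_iff one_add_one by blast
      then show ?thesis
        using that by (simp add: Fmult_def Fn_def mem_Times_iff wedge_scale_right form_add_zero_right
            form_add_mem_Lambda form_scale_mem_Lambda)
    qed
    then show "h_affine n f"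
      using h_affine_expansion[of n \<eta>] \<eta> unfolding h_affine_def by simp
  qed
  show "\<exists>!\<eta>. represents n f \<eta>" if "h_affine n f"
  proof -
    have "\<eta> = \<zeta>" if "represents n f \<eta>" "represents n f \<zeta>" for \<eta> \<zeta>
    proof
      fix k
      \<comment> \<open>Uniqueness by linearity: the difference of the two families has zero
        expansion on the group.\<close>
      let ?d = "\<lambda>k. form_add (\<eta> k) (form_scale (-1) (\<zeta> k))"
      have "?d k = (\<lambda>_. 0)"
        using that unfolding rep
        by (intro expansion_eq_zero) (auto simp: form_add_mem_Lambda form_scale_mem_Lambda expansion_add expansion_scale)
      then show "\<eta> k = \<zeta> k" by (simp add: form_add_def form_scale_def fun_eq_iff)
    qed
    then show ?thesis using ex that by auto
  qed
  fix \<eta> \<theta> \<omega>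
  assume r: "represents n f \<eta>" and F: "(\<theta>, \<omega>) \<in> Fn n"
  \<comment> \<open>\<open>c d\<close> is the part of weight \<open>d\<close> of \<open>f\<close> at
    this point; dilation by \<open>t\<close> multiplies it by \<open>t ^ d\<close>, which makes it
    the coefficient of degree \<open>d\<close>.\<close>
  define c where "c d = wedge (weight_form d (\<theta>, \<omega>)) (\<eta> (n - d)) {..<n}" for d
  define p where "p = (\<Sum>d\<le>n. monom (c d) d)"
  have coeff: "coeff p d = c d" if "d \<le> n" for d
    using that by (simp add: p_def coeff_sum coeff_monom)
  have top: "wedge (weight_form d (\<theta>, \<omega>)) (\<eta> (n - d)) = form_scale (coeff p d) (vol n)" if "d \<le> n" for d
    using wedge_weight_form_top[OF F _ that, of \<eta>] r that unfolding rep by (simp add: coeff c_def)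
  show "\<exists>p :: real poly. degree p \<le> n
      \<and> (\<forall>t>0. f (dil t (\<theta>, \<omega>)) = poly p t)
      \<and> (\<forall>k\<le>n div 2. wedge (wpow \<omega> k) (\<eta> (n - 2*k)) = form_scale (coeff p (2*k)) (vol n))
      \<and> (\<forall>k\<le>(n - 1) div 2. wedge \<theta> (wedge (wpow \<omega> k) (\<eta> (n - 2*k - 1)))
                       = form_scale (coeff p (2*k+1)) (vol n))"
  proof (intro exI[of _ p] conjI allI impI)
    show "degree p \<le> n"
      unfolding p_def by (intro degree_sum_le) (auto intro: order.trans[OF degree_monom_le])
    fix t :: real
    have "dil t (\<theta>, \<omega>) \<in> Fn n" using F by (simp add: dil_def Fn_def form_scale_mem_Lambda)
    then have "f (dil t (\<theta>, \<omega>)) = expansion n \<eta> (dil t (\<theta>, \<omega>))" using r unfolding rep by blast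
    then show "f (dil t (\<theta>, \<omega>)) = poly p t"
      by (simp add: expansion_def weight_form_dil wedge_scale_left form_scale_apply p_def poly_sum poly_monom c_def mult.commute)
  next
    fix k assume "k \<le> n div 2"
    then show "wedge (wpow \<omega> k) (\<eta> (n - 2*k)) = form_scale (coeff p (2*k)) (vol n)"
      using top[of "2 * k"] by (simp add: weight_form_even)
  next
    fix k assume "k \<le> (n - 1) div 2"
    then have "2 * k + 1 \<le> n" using n by linarith
    from top[OF this] show "wedge \<theta> (wedge (wpow \<omega> k) (\<eta> (n - 2*k - 1))) = form_scale (coeff p (2*k+1)) (vol n)"
      unfolding weight_form_odd wedge_assoc by simp
  qed
qed

end
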